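(* Let $\alpha\in\mathbb{R}\setminus\mathbb{Q}$, $E\in\mathbb{R}$, and let $v(x)=\sum_{k=-d}^d\hat v_ke^{2\pi ikx}$, $w(x)=\sum_{k=-l}^l\hat w_ke^{2\pi ikx}$ be real-valued trigonometric polynomials with $\hat v_d\ne0$, $\hat w_l\ne0$. If there exists $H\in C^\omega(\mathbb{R}/\mathbb{Z},Sp_{2l\times2}(\mathbb{R}))$ such that $L^v_{E,w}(x)H(x)=H(x+\alpha)$ for all $x$, then the cocycle $(\alpha,L^w_{E,v})$ is not $PH2$.
   Context: For trigonometric polynomials $p(x)=\sum_{k=-m}^m\hat p_ke^{2\pi ikx}$ ($\hat p_m\ne0$) and $q$, the finite-range operator is $(L^q_{p,\alpha,x}u)_n=\sum_{k=-m}^m\hat p_ku_{n+k}+q(x+n\alpha)u_n$, and $L^q_{E,p}(x)$ denotes the $2m\times2m$ transfer matrix of $L^q_{p,\alpha,x}u=Eu$: its first row is $\frac1{\hat p_m}(-\hat p_{m-1},\dots,-\hat p_1,E-q(x)-\hat p_0,-\hat p_{-1},\dots,-\hat p_{-m})$ and its $(j+1)$-th row is $e_j^T$ ($j=1,\dots,2m-1$). Thus $L^w_{E,v}$ is $2d\times2d$ and $L^v_{E,w}$ is $2l\times2l$. Let $C_w$ be the $l\times l$ upper triangular matrix with $(C_w)_{ij}=\hat w_{l-j+i}$ for $j\ge i$, $S_w=\begin{pmatrix}0&-C_w^*\\C_w&0\end{pmatrix}$, $J=\begin{pmatrix}0&1\\-1&0\end{pmatrix}$, and $Sp_{2l\times2}(\mathbb{R})=\{F\in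 M_{2l\times2}(\mathbb{R}):F^*S_wF=J\}$. A cocycle $(\alpha,A)$ on $\mathbb{C}^m$ is $k$-dominated if there is a continuous invariant splitting $\mathbb{C}^m=E^+(x)\oplus E^-(x)$, $\dim E^+=k$, and $N\ge1$ with $\|A_N(x)u\|>\|A_N(x)u'\|$ for all $x$ and unit $u\in E^+(x)$, $u'\in E^-(x)$, $A_N(x)=A(x+(N-1)\alpha)\cdots A(x)$. A $2d$-dimensional cocycle is $PH2$ if it is $(d-1)$- and $(d+1)$-dominated. *)

theory Defs
  imports Complex_Main "Jordan_Normal_Form.Matrix"
begin

definition trig_poly :: "(int \<Rightarrow> complex) \<Rightarrow> nat \<Rightarrow> real \<Rightarrow> complex" where
  "trig_poly ph m x = (\<Sum>k\<in>{-int m..int m}. ph k * exp (2 * pi * \<i> * of_int k * of_real x))"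

definition transfer_mat :: "(int \<Rightarrow> complex) \<Rightarrow> nat \<Rightarrow> (real \<Rightarrow> complex) \<Rightarrow> real \<Rightarrow> real \<Rightarrow> complex mat" where
  "transfer_mat ph m q E x = mat (2*m) (2*m) (\<lambda>(i,j).
     if i = 0 then
       (if j = m - 1 then of_real E - q x - ph 0 else - ph (int m - 1 - int j)) / ph (int m)
     else if j + 1 = i then 1 else 0)"

definition C_mat :: "(int \<Rightarrow> complex) \<Rightarrow> nat \<Rightarrow> complex mat" where
  "C_mat wh l = mat l l (\<lambda>(i,j). if i \<le> j then wh (int l - int j + int i) else 0)"

definition adjoint_mat :: "complex mat \<Rightarrow> complex mat" where
  "adjoint_mat A = mat (dim_col A) (dim_row A) (\<lambda>(i,j). cnj (A $$ (j,i)))"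

definition S_mat :: "(int \<Rightarrow> complex) \<Rightarrow> nat \<Rightarrow> complex mat" where
  "S_mat wh l = four_block_mat (0\<^sub>m l l) (- adjoint_mat (C_mat wh l)) (C_mat wh l) (0\<^sub>m l l)"

definition J_mat :: "complex mat" where
  "J_mat = mat 2 2 (\<lambda>(i,j). if i = 0 \<and> j = 1 then 1 else if i = 1 \<and> j = 0 then -1 else 0)"

definition Sp_set :: "(int \<Rightarrow> complex) \<Rightarrow> nat \<Rightarrow> real mat set" where
  "Sp_set wh l = {F. F \<in> carrier_mat (2*l) 2 \<and>
      adjoint_mat (map_mat complex_of_real F) * S_mat wh l * map_mat complex_of_real F = J_mat}"

definition real_analytic :: "(real \<Rightarrow> real) \<Rightarrow> bool" where
  "real_analytic f \<longleftrightarrow> (\<forall>x0. \<exists>r>0. \<exists>c :: nat \<Rightarrow> real.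
      \<forall>y. \<bar>y - x0\<bar> < r \<longrightarrow> (\<lambda>n. c n * (y - x0) ^ n) sums f y)"

definition analytic_Sp_map :: "(int \<Rightarrow> complex) \<Rightarrow> nat \<Rightarrow> (real \<Rightarrow> real mat) \<Rightarrow> bool" where
  "analytic_Sp_map wh l H \<longleftrightarrow> (\<forall>x. H x \<in> Sp_set wh l) \<and> (\<forall>x. H (x + 1) = H x) \<and>
     (\<forall>i<2*l. \<forall>j<2. real_analytic (\<lambda>x. H x $$ (i,j)))"

definition vnorm :: "complex vec \<Rightarrow> real" where
  "vnorm u = sqrt (\<Sum>i<dim_vec u. (cmod (u $ i))\<^sup>2)"

definition lin_comb :: "nat \<Rightarrow> nat \<Rightarrow> (nat \<Rightarrow> complex vec) \<Rightarrow> (nat \<Rightarrow> complex) \<Rightarrow> complex vec" where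
  "lin_comb m k b c = vec m (\<lambda>j. \<Sum>i<k. c i * (b i $ j))"

definition is_basis :: "nat \<Rightarrow> nat \<Rightarrow> (nat \<Rightarrow> complex vec) \<Rightarrow> complex vec set \<Rightarrow> bool" where
  "is_basis m k b S \<longleftrightarrow> (\<forall>i<k. b i \<in> carrier_vec m) \<and>
     (\<forall>c. lin_comb m k b c = 0\<^sub>v m \<longrightarrow> (\<forall>i<k. c i = 0)) \<and>
     S = {lin_comb m k b c | c. True}"

definition cont_subspaces :: "nat \<Rightarrow> nat \<Rightarrow> (real \<Rightarrow> complex vec set) \<Rightarrow> bool" where
  "cont_subspaces m k F \<longleftrightarrow> (\<forall>x0. \<exists>e>0. \<exists>b :: nat \<Rightarrow> real \<Rightarrow> complex vec.
      (\<forall>x. \<bar>x - x0\<bar> < e \<longrightarrow> is_basis m k (\<lambda>i. b i x) (F x)) \<and>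
      (\<forall>i<k. \<forall>j<m. continuous_on {x0 - e<..<x0 + e} (\<lambda>x. b i x $ j)))"

fun cocycle_iter :: "nat \<Rightarrow> real \<Rightarrow> (real \<Rightarrow> complex mat) \<Rightarrow> nat \<Rightarrow> real \<Rightarrow> complex mat" where
  "cocycle_iter m \<alpha> A 0 x = 1\<^sub>m m"
| "cocycle_iter m \<alpha> A (Suc n) x = A (x + real n * \<alpha>) * cocycle_iter m \<alpha> A n x"

definition dominated :: "nat \<Rightarrow> nat \<Rightarrow> real \<Rightarrow> (real \<Rightarrow> complex mat) \<Rightarrow> bool" where
  "dominated m k \<alpha> A \<longleftrightarrow> (\<exists>Ep Em :: real \<Rightarrow> complex vec set. \<exists>N::nat.
      N \<ge> 1 \<and>
      cont_subspaces m k Ep \<and> cont_subspaces m (m - k) Em \<and>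
      (\<forall>x. Ep (x + 1) = Ep x \<and> Em (x + 1) = Em x) \<and>
      (\<forall>x. Ep x \<inter> Em x = {0\<^sub>v m} \<and>
           (\<forall>u\<in>carrier_vec m. \<exists>a\<in>Ep x. \<exists>b\<in>Em x. u = a + b)) \<and>
      (\<forall>x. (\<lambda>u. A x *\<^sub>v u) ` Ep x = Ep (x + \<alpha>) \<and> (\<lambda>u. A x *\<^sub>v u) ` Em x = Em (x + \<alpha>)) \<and>
      (\<forall>x. \<forall>u\<in>Ep x. \<forall>u'\<in>Em x. vnorm u = 1 \<longrightarrow> vnorm u' = 1 \<longrightarrow>
           vnorm (cocycle_iter m \<alpha> A N x *\<^sub>v u) > vnorm (cocycle_iter m \<alpha> A N x *\<^sub>v u')))"

definition PH2 :: "nat \<Rightarrow> real \<Rightarrow> (real \<Rightarrow> complex mat) \<Rightarrow> bool" where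
  "PH2 d \<alpha> A \<longleftrightarrow> dominated (2*d) (d - 1) \<alpha> A \<and> dominated (2*d) (d + 1) \<alpha> A"

end

theory Submission
  imports Defs
    "Jordan_Normal_Form.Determinant"
    "HOL-Analysis.Weierstrass_Theorems"
    "HOL-Analysis.Complex_Transcendental"
    "HOL-Analysis.Equivalence_Lebesgue_Henstock_Integration"
    "HOL-Analysis.L2_Norm"
begin

text \<open>
  By Aubry duality the Fourier coefficients of the two columns of \<open>H\<close> are two solutions of the dual
  eigenvalue equation at phase 0, linearly independent because \<open>H\<close> pulls the form \<open>S\<^sub>w\<close> back to \<open>J\<close>,
  and tending to zero in both directions. The dual cocycle preserves the nondegenerate form \<open>S\<^sub>v\<close>
  on a space of dimension \<open>2d\<close>. If it were \<open>(d-1)\<close>-dominated with splitting \<open>P \<oplus> Q\<close>, then \<open>Q\<close>, of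
  dimension \<open>d+1\<close>, would not be isotropic, so conservation of the form prevents \<open>Q\<close> from contracting
  and \<open>P\<close> must expand uniformly. Hence everything in \<open>P(0)\<close> and the two decaying solutions have backward
  orbits tending to zero, so they span an isotropic space; the sum is direct since \<open>P\<close> expands
  forwards. Its dimension \<open>d+1\<close> exceeds the maximal dimension \<open>d\<close> of an isotropic space.
\<close>

no_notation Finite_Cartesian_Product.vec_nth (infixl "$" 90)

section \<open>Fourier coefficients of periodic functions\<close>

text \<open>Domination compares the two bundles only with each other, and the solutions obtained by
  duality tend to zero without a rate. What reconciles this is the bounded conserved form. Evaluated
  on two null sequences it tends to zero however slowly they decay. Evaluated on the right pair it
  is a squared norm: the pairing of \<open>S q\<close> with \<open>q\<close> is the square of
  \<open>vnorm (S *\<^sub>v q)\<close>. Such pairs come from one count, used twice. If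
  \<open>b\<close> has d + 1 independent members, the 2 (d + 1) vectors \<open>b i\<close> and
  \<open>S *\<^sub>v b i\<close> are dependent in dimension 2 d, so the span of \<open>b\<close>
  contains some nonzero \<open>q\<close> together with \<open>S q\<close>. For the dominated bundle
  this yields absolute expansion of the other bundle; for the final isotropic family it yields the
  contradiction. Independence of the two solutions takes a detour: a relation between their states
  at one time holds at all times, hence between all Fourier coefficients, hence (uniqueness theorem)
  between two entries of one row of \<open>H\<close> at every phase. The other rows are translates
  of that row, so the columns of \<open>H\<close> are dependent, which the form \<open>J\<close>
  excludes.\<close>

definition ee :: "int \<Rightarrow> real \<Rightarrow> complex" where
  "ee k x = exp (2 * pi * \<i> * of_int k * of_real x)"

lemma ee_mult: "ee m x * ee n x = ee (m + n) x"
  by (simp add: ee_def exp_add [symmetric] ring_distribs)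

lemma ee_add: "ee n (x + y) = ee n x * ee n y"
  by (simp add: ee_def exp_add [symmetric] ring_distribs)

lemma ee_0 [simp]: "ee 0 x = 1"
  by (simp add: ee_def)

lemma norm_ee [simp]: "cmod (ee n x) = 1"
  by (simp add: ee_def norm_exp_eq_Re)

lemma cnj_ee: "cnj (ee n x) = ee (- n) x"
  by (simp add: ee_def exp_cnj)

lemma ee_periodic: "ee n (x + 1) = ee n x"
proof -
  have "ee n 1 = 1"
    using exp_2pi_1_int[of n] by (simp add: ee_def mult_ac)
  then show ?thesis by (simp add: ee_add)
qed

lemma continuous_on_ee [continuous_intros]: "continuous_on S (ee n)"
  unfolding ee_def by (intro continuous_intros)

lemma ee_of_int: "ee n (of_int k * x) = ee (n * k) x"
  by (simp add: ee_def mult_ac)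

lemma integral_ee: "integral {0..1} (ee n) = (if n = 0 then 1 else 0)"
proof (cases "n = 0")
  case True
  have "ee 0 = (\<lambda>x. 1)" by (simp add: fun_eq_iff)
  with True show ?thesis by simp
next
  case False
  let ?c = "2 * pi * \<i> * of_int n :: complex"
  have c: "?c \<noteq> 0" using False by simp
  have "((\<lambda>x. ee n x / ?c) has_vector_derivative ee n x) (at x within {0..1})" for x
    unfolding ee_def using c
    by (auto intro!: derivative_eq_intros has_vector_derivative_real_field)
  then have "(ee n has_integral (ee n 1 / ?c - ee n 0 / ?c)) {0..1}"
    by (intro fundamental_theorem_of_calculus) auto
  moreover have "ee n 1 = ee n 0" using ee_periodic[of n 0] by simp
  ultimately show ?thesis using False by (simp add: integral_unique)
qed

lemma periodic_of_int:
  assumes "\<And>x::real. f (x + 1) = f x"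
  shows "f (x + of_int k) = f x"
proof (induction k rule: int_induct[where k=0])
  case (step1 i) then show ?case using assms[of "x + of_int i"] by (simp add: add_ac)
next
  case (step2 i) then show ?case using assms[of "x + of_int (i - 1)"] by (simp add: add_ac)
qed simp

text \<open>Modulo whole periods the shift is \<open>frac a\<close>; the piece of the shifted
  interval beyond 1 is moved back by one period.\<close>

lemma integral_periodic_shift:
  fixes f :: "real \<Rightarrow> complex"
  assumes per: "\<And>x. f (x + 1) = f x" and cont: "continuous_on UNIV f"
  shows "integral {0..1} (\<lambda>x. f (x + a)) = integral {0..1} f"
proof -
  let ?b = "frac a"
  have b: "0 \<le> ?b" "?b \<le> 1" using frac_lt_1[of a] by (auto simp: less_imp_le)
  have int: "f integrable_on {u..v}" for u v
    by (meson cont continuous_on_subset integrable_continuous_real subset_UNIV)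
  have "f (x + a) = f (x + ?b)" for x
    using periodic_of_int[of f "x + ?b" "\<lfloor>a\<rfloor>", OF per] by (simp add: frac_def)
  then have "integral {0..1} (\<lambda>x. f (x + a)) = integral {0..1} (\<lambda>x. f (x + ?b))" by simp
  also have "\<dots> = integral {?b..1 + ?b} f"
    using integral_shift_real_ivl[of ?b ?b "1 + ?b" f] by simp
  also have "\<dots> = integral {?b..1} f + integral {1..1 + ?b} f"
    using b by (intro integral_combine [symmetric] int) auto
  also have "integral {1..1 + ?b} f = integral {0..?b} (\<lambda>x. f (x + 1))"
    using integral_shift_real_ivl[of 1 1 "1 + ?b" f] by simp
  also have "\<dots> = integral {0..?b} f" by (simp add: per)
  also have "integral {?b..1} f + integral {0..?b} f = integral {0..1} f"
    using b integral_combine[of 0 ?b 1 f] int by (simp add: add.commute)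
  finally show ?thesis .
qed

text \<open>The kernel is \<open>ee n\<close>, so this is the usual coefficient with index
  \<open>- n\<close>. With this sign multiplication by \<open>ee k\<close> raises the index by
  \<open>k\<close>, which is the form \<open>u (n + k)\<close> of the finite-range operator.\<close>

definition fourier :: "(real \<Rightarrow> complex) \<Rightarrow> int \<Rightarrow> complex" where
  "fourier f n = integral {0..1} (\<lambda>x. f x * ee n x)"

lemma integrable_ee:
  assumes "continuous_on UNIV f"
  shows "(\<lambda>x. f x * ee n x) integrable_on {a..b}"
  by (intro integrable_continuous_real continuous_intros continuous_on_subset[OF assms]) auto

lemma fourier_shift:
  assumes per: "\<And>x. f (x + 1) = f x" and cont: "continuous_on UNIV f"
  shows "fourier (\<lambda>x. f (x + a)) n = ee (- n) a * fourier f n"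
proof -
  have "f (x + a) * ee n x = ee (- n) a * (f (x + a) * ee n (x + a))" for x
  proof -
    have "ee (- n) a * ee n a = 1" by (simp add: ee_mult)
    then show ?thesis by (simp add: ee_add algebra_simps)
  qed
  then have eq: "(\<lambda>x. f (x + a) * ee n x) = (\<lambda>x. ee (- n) a * (f (x + a) * ee n (x + a)))" by (rule ext)
  have "fourier (\<lambda>x. f (x + a)) n = ee (- n) a * integral {0..1} (\<lambda>x. f (x + a) * ee n (x + a))"
    unfolding fourier_def eq by (rule integral_mult_right)
  also have "integral {0..1} (\<lambda>x. f (x + a) * ee n (x + a)) = fourier f n"
    unfolding fourier_def
    by (rule integral_periodic_shift[of "\<lambda>x. f x * ee n x"])
       (auto simp: per ee_periodic intro!: continuous_intros cont)
  finally show ?thesis .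
qed

lemma fourier_cmult: "fourier (\<lambda>x. c * f x) n = c * fourier f n"
  by (simp add: fourier_def mult.assoc)

lemma fourier_add:
  assumes "continuous_on UNIV f" "continuous_on UNIV g"
  shows "fourier (\<lambda>x. f x + g x) n = fourier f n + fourier g n"
  unfolding fourier_def using assms
  by (subst integral_add [symmetric]) (auto simp: ring_distribs intro: integrable_ee)

lemma fourier_sum:
  assumes "finite I" "\<And>i. i \<in> I \<Longrightarrow> continuous_on UNIV (f i)"
  shows "fourier (\<lambda>x. \<Sum>i\<in>I. f i x) n = (\<Sum>i\<in>I. fourier (f i) n)"
  using assms
proof (induction rule: finite_induct)
  case empty then show ?case by (simp add: fourier_def)
next
  case (insert i I)
  then show ?case by (simp add: fourier_add continuous_on_sum)
qed

lemma fourier_mult_ee: "fourier (\<lambda>x. f x * ee k x) n = fourier f (n + k)"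
  unfolding fourier_def by (simp add: mult.assoc ee_mult add.commute)

lemma norm_fourier_le:
  assumes "continuous_on UNIV f" "\<And>x. cmod (f x) \<le> B"
  shows "cmod (fourier f n) \<le> B"
proof -
  have "cmod (fourier f n) \<le> B * (1 - 0)"
    unfolding fourier_def
    by (rule integral_bound) (auto intro!: continuous_intros continuous_on_subset[OF assms(1)] simp: norm_mult assms)
  then show ?thesis by simp
qed

lemma periodic_uniformly_continuous:
  fixes f :: "real \<Rightarrow> complex"
  assumes per: "\<And>x. f (x + 1) = f x" and cont: "continuous_on UNIV f" and "e > 0"
  obtains r where "r > 0" "\<And>x h. \<bar>h\<bar> < r \<Longrightarrow> cmod (f (x + h) - f x) < e"
proof -
  \<comment> \<open>One period enlarged by 1 on both sides, so that \<open>frac x + h\<close> stays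
    inside whenever \<open>h\<close> has modulus below 1.\<close>
  have "uniformly_continuous_on {-1..2} f"
    by (intro compact_uniformly_continuous continuous_on_subset[OF cont]) auto
  then obtain r where r: "r > 0"
    "\<And>x x'. x \<in> {-1..2} \<Longrightarrow> x' \<in> {-1..2} \<Longrightarrow> dist x' x < r \<Longrightarrow> dist (f x') (f x) < e"
    using \<open>e > 0\<close> unfolding uniformly_continuous_on_def by metis
  have "cmod (f (x + h) - f x) < e" if "\<bar>h\<bar> < min r 1" for x h
  proof -
    have b: "0 \<le> frac x" "frac x \<le> 1" using frac_lt_1[of x] by (auto simp: less_imp_le)
    have "dist (f (frac x + h)) (f (frac x)) < e"
      by (intro r; unfold atLeastAtMost_iff dist_real_def; use that b in linarith)
    moreover have "f (frac x) = f x" "f (frac x + h) = f (x + h)"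
      using periodic_of_int[of f "frac x" "\<lfloor>x\<rfloor>", OF per]
        periodic_of_int[of f "frac x + h" "\<lfloor>x\<rfloor>", OF per] by (simp_all add: frac_def algebra_simps)
    ultimately show ?thesis by (simp add: dist_norm)
  qed
  then show ?thesis using that[of "min r 1"] r(1) by auto
qed

(* Shifting by 1/(2n) changes the sign of ee n. *)
lemma riemann_lebesgue:
  assumes per: "\<And>x. f (x + 1) = f x" and cont: "continuous_on UNIV f" and "e > 0"
  shows "\<exists>K. \<forall>n. \<bar>n\<bar> > K \<longrightarrow> cmod (fourier f n) < e"
proof -
  obtain r where r: "r > 0" "\<And>x h. \<bar>h\<bar> < r \<Longrightarrow> cmod (f (x + h) - f x) < e"
    using periodic_uniformly_continuous[OF per cont \<open>e > 0\<close>] by metis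
  have "cmod (fourier f n) < e" if n: "\<bar>n\<bar> > \<lceil>1 / r\<rceil>" for n
  proof -
    have "0 < 1 / r" using r by simp
    then have n0: "n \<noteq> 0" using n by linarith
    define a where "a = 1 / (2 * real_of_int n)"
    have n1: "real_of_int \<bar>n\<bar> > 1 / r" using n by linarith
    have "\<bar>a\<bar> < r"
    proof -
      have "\<bar>a\<bar> = 1 / (2 * real_of_int \<bar>n\<bar>)" by (simp add: a_def abs_mult)
      also have "\<dots> < r" using n1 r(1) n0 by (simp add: field_simps)
      finally show ?thesis .
    qed
    have "ee (- n) a = -1"
    proof -
      have "2 * pi * \<i> * of_int (- n) * of_real a = - (\<i> * of_real pi)"
        using n0 by (simp add: a_def)
      then show ?thesis unfolding ee_def by (simp only:) (simp add: exp_minus)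
    qed
    then have s: "fourier (\<lambda>x. f (x + a)) n = - fourier f n"
      using fourier_shift[OF per cont, of a n] by simp
    have c2: "continuous_on UNIV (\<lambda>x. f (x + a))"
      by (intro continuous_on_compose2[OF cont] continuous_intros) auto
    \<comment> \<open>The difference of \<open>f\<close> and its translate is uniformly below
      \<open>e\<close>, while the sign change doubles its coefficient. The factor 2 turns the weak
      bound on an integral into the strict one claimed.\<close>
    have "fourier (\<lambda>x. f (x + a) + (-1) * f x) n = - 2 * fourier f n"
      by (subst fourier_add) (use s cont c2 in \<open>auto intro!: continuous_intros simp: fourier_cmult[of "-1", simplified]\<close>)
    moreover have "cmod (fourier (\<lambda>x. f (x + a) + (-1) * f x) n) \<le> e"
      by (rule norm_fourier_le) (use cont c2 r(2)[OF \<open>\<bar>a\<bar> < r\<close>] in \<open>auto intro!: continuous_intros less_imp_le\<close>)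
    ultimately have "2 * cmod (fourier f n) \<le> e" by (simp add: norm_mult)
    then show ?thesis using \<open>e > 0\<close> by (smt (verit) norm_ge_zero)
  qed
  then show ?thesis by blast
qed

section \<open>Uniqueness theorem for Fourier coefficients\<close>

lemma continuous_on_mult_polynomial_ee:
  assumes "continuous_on UNIV f" "real_polynomial_function p"
  shows "continuous_on UNIV (\<lambda>x. f x * complex_of_real (p (ee 1 x)))"
proof -
  have "continuous_on UNIV p"
    using continuous_real_polymonial_function[OF assms(2)] by (simp add: continuous_at_imp_continuous_on)
  then have "continuous_on UNIV (\<lambda>x. p (ee 1 x))"
    by (rule continuous_on_compose2[OF _ continuous_on_ee]) auto
  then show ?thesis by (intro continuous_on_mult assms continuous_on_of_real)
qed

text \<open>On the unit circle a real linear form is a combination of \<open>ee 1\<close> and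
  \<open>ee (-1)\<close>, and multiplication by these only shifts the coefficients. For products the
  induction hypothesis is applied to \<open>f\<close> times a polynomial, so \<open>f\<close> has to
  vary.\<close>

lemma fourier_zero_mult_polynomial:
  assumes "real_polynomial_function p"
  shows "continuous_on UNIV f \<Longrightarrow> (\<And>n. fourier f n = 0) \<Longrightarrow> fourier (\<lambda>x. f x * of_real (p (ee 1 x))) n = 0"
  using assms
proof (induction p arbitrary: f n rule: real_polynomial_function.induct)
  case (linear h)
  interpret h: bounded_linear h by fact
  have h: "h z = Re z * h 1 + Im z * h \<i>" for z
  proof -
    have "z = Re z *\<^sub>R 1 + Im z *\<^sub>R \<i>" by (simp add: complex_eq_iff)
    then show ?thesis by (metis h.add h.scaleR real_scaleR_def)
  qed
  \<comment> \<open>The coordinates of the real-linear \<open>h\<close> with respect to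
    \<open>z\<close> and \<open>cnj z\<close>.\<close>
  define a b where "a = Complex (h 1 / 2) (- h \<i> / 2)" and "b = Complex (h 1 / 2) (h \<i> / 2)"
  have "of_real (h z) = a * z + b * cnj z" for z
    unfolding h[of z] by (simp add: complex_eq_iff a_def b_def)
  then have eq: "(\<lambda>x. f x * of_real (h (ee 1 x))) = (\<lambda>x. a * (f x * ee 1 x) + b * (f x * ee (-1) x))"
    by (simp add: fun_eq_iff cnj_ee algebra_simps)
  have c: "continuous_on UNIV (\<lambda>x. c * (f x * ee k x))" for c k
    by (intro continuous_on_mult linear continuous_on_const continuous_on_ee)
  show ?case
    unfolding eq fourier_add[OF c c] fourier_cmult fourier_mult_ee by (simp add: linear)
next
  case (const c)
  then show ?case using fourier_cmult[of "of_real c" f n] by (simp add: mult.commute)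
next
  case (add p q)
  then show ?case by (simp add: ring_distribs fourier_add continuous_on_mult_polynomial_ee)
next
  case (mult p q)
  then show ?case
    using mult.IH(2)[of "\<lambda>x. f x * of_real (p (ee 1 x))" n] by (simp add: mult.assoc continuous_on_mult_polynomial_ee)
qed

lemma ee_1_range: "ee 1 ` {0..1} = sphere 0 1"
proof
  show "ee 1 ` {0..1} \<subseteq> sphere 0 1" by auto
  show "sphere 0 1 \<subseteq> ee 1 ` {0..1}"
  proof
    fix z :: complex assume "z \<in> sphere 0 1"
    then obtain t where "0 \<le> t" "t < 2 * pi" "z = Complex (cos t) (sin t)"
      using complex_unimodular_polar[of z] by auto
    then show "z \<in> ee 1 ` {0..1}"
      by (intro image_eqI[where x = "t / (2 * pi)"]) (auto simp: ee_def complex_eq_iff Re_exp Im_exp)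
  qed
qed

text \<open>Regarded as a function on the circle, \<open>f\<close> is a uniform limit of real
  polynomials, and it is orthogonal to each of them; hence the integral of \<open>f * f\<close>
  vanishes. For real \<open>f\<close> the integrand is nonnegative, so \<open>f\<close> is
  zero.\<close>

lemma fourier_zero_real:
  fixes f :: "real \<Rightarrow> real"
  assumes per: "\<And>x. f (x + 1) = f x" and cont: "continuous_on UNIV f"
    and zero: "\<And>n. fourier (\<lambda>x. of_real (f x)) n = 0"
  shows "f x = 0"
proof -
  have inj: "f x = f y" if "x \<in> {0..1}" "y \<in> {0..1}" "ee 1 x = ee 1 y" for x y
  proof -
    have "\<exists>k::int. 2 * pi * \<i> * of_real x = 2 * pi * \<i> * of_real y + (2 * of_int k * pi) * \<i>"
      using that(3) unfolding ee_def exp_eq by auto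
    then obtain k :: int where "2 * pi * \<i> * of_real x = 2 * pi * \<i> * of_real y + (2 * of_int k * pi) * \<i>" ..
    then have "2 * pi * (x - y) = 2 * pi * of_int k"
      by (simp add: complex_eq_iff algebra_simps)
    then have "x - y = of_int k" by simp
    then show ?thesis using periodic_of_int[of f y k, OF per] by (simp add: algebra_simps)
  qed
  define F where "F z = f (SOME x. x \<in> {0..1} \<and> ee 1 x = z)" for z
  have F: "F (ee 1 x) = f x" if "x \<in> {0..1}" for x
    unfolding F_def using inj[OF _ that] by (metis (mono_tags, lifting) someI_ex that)
  \<comment> \<open>The map \<open>ee 1\<close> from the compact interval onto the circle is a
    quotient map, so continuity of \<open>f\<close> descends to \<open>F\<close>.\<close>
  have contF: "continuous_on (sphere 0 1) F"
    unfolding continuous_openin_preimage_eq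
  proof (intro allI impI)
    fix U :: "real set" assume "open U"
    have "{0..1} \<inter> ee 1 -` (sphere 0 1 \<inter> F -` U) = {0..1} \<inter> f -` U"
      using F by auto
    moreover have "openin (top_of_set {0..1}) ({0..1} \<inter> f -` U)"
      using continuous_on_subset[OF cont] \<open>open U\<close> by (intro continuous_openin_preimage_gen) auto
    ultimately show "openin (top_of_set (sphere 0 1)) (sphere 0 1 \<inter> F -` U)"
      using Abstract_Topology_2.continuous_imp_quotient_map[of "{0..1}" "ee 1" "sphere 0 1" "sphere 0 1 \<inter> F -` U"]
      by (simp add: ee_1_range continuous_on_ee)
  qed
  have "continuous_on {0..1} (\<lambda>x. \<bar>f x\<bar>)"
    by (intro continuous_on_rabs continuous_on_subset[OF cont]) auto
  then obtain y where "\<forall>x\<in>{0..1}. \<bar>f x\<bar> \<le> \<bar>f y\<bar>"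
    using continuous_attains_sup[of "{0..1::real}" "\<lambda>x. \<bar>f x\<bar>"] by auto
  note y = bspec[OF this]
  have frac: "frac x \<in> {0..1}" "f (frac x) = f x" "ee 1 (frac x) = ee 1 x" for x
    using frac_lt_1[of x] periodic_of_int[of f "frac x" "\<lfloor>x\<rfloor>", OF per]
      periodic_of_int[of "ee 1" "frac x" "\<lfloor>x\<rfloor>", OF ee_periodic] by (auto simp: less_imp_le frac_def)
  have le_y: "\<bar>f x\<bar> \<le> \<bar>f y\<bar>" and F': "F (ee 1 x) = f x" for x
    using y[OF frac(1)[of x]] F[OF frac(1)[of x]] frac[of x] by auto
  have contc: "continuous_on UNIV (\<lambda>x. complex_of_real (f x))"
    by (intro continuous_intros cont)
  let ?I = "fourier (\<lambda>x. of_real (f x) * of_real (f x)) 0"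
  have "cmod ?I \<le> \<bar>f y\<bar> * e" if "e > 0" for e
  proof -
    obtain p where p: "real_polynomial_function p" "\<And>z. z \<in> sphere 0 1 \<Longrightarrow> \<bar>F z - p z\<bar> < e"
      using Stone_Weierstrass_real_polynomial_function[OF compact_sphere contF \<open>e > 0\<close>] by blast
    have contp: "continuous_on UNIV (\<lambda>x. complex_of_real (p (ee 1 x)))"
      using continuous_on_mult_polynomial_ee[OF continuous_on_const[of UNIV 1] p(1)] by simp
    have "?I = fourier (\<lambda>x. of_real (f x) * of_real (f x) + (-1) * (of_real (f x) * of_real (p (ee 1 x)))) 0"
      using contc contp fourier_zero_mult_polynomial[OF p(1) contc zero]
      by (subst fourier_add) (auto intro!: continuous_intros simp: fourier_cmult[of "-1", simplified])
    also have "(\<lambda>x. of_real (f x) * of_real (f x) + (-1) * (of_real (f x) * of_real (p (ee 1 x)))) = (\<lambda>x. complex_of_real (f x * (f x - p (ee 1 x))))"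
      by (simp add: fun_eq_iff algebra_simps)
    also have "cmod (fourier \<dots> 0) \<le> \<bar>f y\<bar> * e"
    proof (rule norm_fourier_le)
      show "continuous_on UNIV (\<lambda>x. complex_of_real (f x * (f x - p (ee 1 x))))"
        using contc contp by (auto intro!: continuous_intros)
      show "cmod (of_real (f x * (f x - p (ee 1 x)))) \<le> \<bar>f y\<bar> * e" for x
        unfolding norm_of_real abs_mult using le_y[of x] p(2)[of "ee 1 x"] F'[of x]
        by (intro mult_mono) auto
    qed
    finally show ?thesis .
  qed
  note bound = this
  have "cmod ?I \<le> 0"
  proof (rule field_le_epsilon)
    fix e :: real assume "e > 0"
    \<comment> \<open>The \<open>+ 1\<close> keeps the denominator positive when
      \<open>f y = 0\<close>.\<close>
    then have "cmod ?I \<le> \<bar>f y\<bar> * (e / (\<bar>f y\<bar> + 1))" by (intro bound) auto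
    also have "\<dots> \<le> 0 + e" using \<open>e > 0\<close> by (simp add: field_simps)
    finally show "cmod ?I \<le> 0 + e" .
  qed
  then have "?I = 0" by simp
  moreover have "(\<lambda>x. f x * f x) integrable_on {0..1}"
    by (intro integrable_continuous_real continuous_on_mult continuous_on_subset[OF cont]) auto
  then have "integral {0..1} (\<lambda>x. complex_of_real (f x * f x)) = of_real (integral {0..1} (\<lambda>x. f x * f x))"
    by (intro integral_unique has_integral_of_real integrable_integral)
  ultimately have "complex_of_real (integral {0..1} (\<lambda>x. f x * f x)) = 0"
    by (simp add: fourier_def)
  then have "integral {0..1} (\<lambda>x. f x * f x) = 0" by simp
  then have "\<forall>x\<in>{0..1}. f x * f x = 0"
    by (subst (asm) integral_eq_0_iff) (auto intro!: continuous_on_mult continuous_on_subset[OF cont])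
  then show ?thesis using frac[of x] by auto
qed

lemma fourier_cnj: "fourier (\<lambda>x. cnj (f x)) n = cnj (fourier f (- n))"
  unfolding fourier_def by (simp add: integral_cnj cnj_ee)

lemma fourier_zero:
  assumes per: "\<And>x. f (x + 1) = f x" and cont: "continuous_on UNIV f"
    and zero: "\<And>n. fourier f n = 0"
  shows "f x = 0"
proof -
  have c: "continuous_on UNIV (\<lambda>x. cnj (f x))" by (intro continuous_intros cont)
  have re: "complex_of_real (Re (f x)) = 1/2 * f x + 1/2 * cnj (f x)"
    and im: "complex_of_real (Im (f x)) = - \<i>/2 * f x + \<i>/2 * cnj (f x)" for x
    by (auto simp: complex_eq_iff)
  have "Re (f x) = 0" for x
  proof (rule fourier_zero_real[of "\<lambda>x. Re (f x)"])
    show "fourier (\<lambda>x. of_real (Re (f x))) n = 0" for n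
      unfolding re by (subst fourier_add, (intro continuous_intros c cont)+) (simp only: fourier_cmult fourier_cnj zero, simp)
  qed (use per cont in \<open>auto intro: continuous_intros\<close>)
  moreover have "Im (f x) = 0" for x
  proof (rule fourier_zero_real[of "\<lambda>x. Im (f x)"])
    show "fourier (\<lambda>x. of_real (Im (f x))) n = 0" for n
      unfolding im by (subst fourier_add, (intro continuous_intros c cont)+) (simp only: fourier_cmult fourier_cnj zero, simp)
  qed (use per cont in \<open>auto intro: continuous_intros\<close>)
  ultimately show ?thesis by (simp add: complex_eq_iff)
qed

section \<open>Aubry duality\<close>

lemma trig_poly_ee: "trig_poly ph m x = (\<Sum>k\<in>{-int m..int m}. ph k * ee k x)"
  by (simp add: trig_poly_def ee_def)

lemma continuous_on_trig_poly [continuous_intros]: "continuous_on S (trig_poly ph m)"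
  unfolding trig_poly_ee by (intro continuous_intros)

lemma trig_poly_periodic: "trig_poly ph m (x + 1) = trig_poly ph m x"
  by (simp add: trig_poly_ee ee_periodic)

lemma fourier_ee: "fourier (ee k) n = (if n = - k then 1 else 0)"
  by (auto simp: fourier_def ee_mult integral_ee)

lemma fourier_trig_poly:
  assumes "\<bar>n\<bar> \<le> int m"
  shows "fourier (trig_poly ph m) n = ph (- n)"
proof -
  have "fourier (trig_poly ph m) n = (\<Sum>k\<in>{-int m..int m}. ph k * (if n = - k then 1 else 0))"
    unfolding trig_poly_ee
    by (subst fourier_sum) (auto intro!: continuous_intros simp: fourier_cmult fourier_ee)
  also have "\<dots> = (\<Sum>k\<in>{-int m..int m}. if k = - n then ph k else 0)"
    by (intro sum.cong) auto
  finally show ?thesis using assms by auto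
qed

text \<open>A real-valued polynomial equals its conjugate, and the coefficients are compared. This
  symmetry is what makes the transfer matrices preserve the form.\<close>

lemma trig_poly_real_coeff:
  assumes "\<forall>x. trig_poly ph m x \<in> \<real>" "\<bar>k\<bar> \<le> int m"
  shows "ph (- k) = cnj (ph k)"
proof -
  have "(\<lambda>x. cnj (trig_poly ph m x)) = trig_poly ph m"
    using assms(1) by (simp add: Reals_cnj_iff)
  then have "fourier (trig_poly ph m) k = cnj (fourier (trig_poly ph m) (- k))"
    using fourier_cnj[of "trig_poly ph m" k] by simp
  then show ?thesis using assms(2) by (simp add: fourier_trig_poly)
qed

(* Conjugating the equation (g is real) makes the phases n * alpha appear with the sign needed on the dual side. *)
lemma fourier_dual_equation:
  assumes w_real: "\<forall>x. trig_poly wh l x \<in> \<real>" and v_real: "\<forall>x. trig_poly vh d x \<in> \<real>"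
    and per: "\<And>x. g (x + 1) = g x" and cont: "continuous_on UNIV g" and g_real: "\<And>x. cnj (g x) = g x"
    and eq: "\<And>x. (\<Sum>k\<in>{-int l..int l}. wh k * g (x + of_int k * \<alpha>)) + trig_poly vh d x * g x = of_real E * g x"
  shows "(\<Sum>j\<in>{-int d..int d}. vh j * fourier g (n + j)) + trig_poly wh l (of_int n * \<alpha>) * fourier g n = of_real E * fourier g n"
proof -
  have "(\<lambda>x. (\<Sum>k\<in>{-int l..int l}. cnj (wh k) * g (x + of_int k * \<alpha>)) + (\<Sum>j\<in>{-int d..int d}. vh j * (g x * ee j x)))
    = (\<lambda>x. of_real E * g x)"
  proof
    fix x
    have "cnj ((\<Sum>k\<in>{-int l..int l}. wh k * g (x + of_int k * \<alpha>)) + trig_poly vh d x * g x) = cnj (of_real E * g x)"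
      by (simp only: eq)
    moreover have "cnj (trig_poly vh d x) = trig_poly vh d x"
      using v_real by (simp add: Reals_cnj_iff)
    ultimately have "(\<Sum>k\<in>{-int l..int l}. cnj (wh k) * g (x + of_int k * \<alpha>)) + trig_poly vh d x * g x = of_real E * g x"
      by (simp only: complex_cnj_add complex_cnj_mult cnj_sum g_real complex_cnj_complex_of_real)
    then show "(\<Sum>k\<in>{-int l..int l}. cnj (wh k) * g (x + of_int k * \<alpha>)) + (\<Sum>j\<in>{-int d..int d}. vh j * (g x * ee j x)) = of_real E * g x"
      by (simp add: trig_poly_ee[of vh] sum_distrib_left mult_ac)
  qed
  moreover have cs: "continuous_on UNIV (\<lambda>x. g (x + a))" for a
    by (intro continuous_on_compose2[OF cont] continuous_intros) auto
  ultimately have "(\<Sum>k\<in>{-int l..int l}. cnj (wh k) * fourier (\<lambda>x. g (x + of_int k * \<alpha>)) n)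
      + (\<Sum>j\<in>{-int d..int d}. vh j * fourier (\<lambda>x. g x * ee j x) n) = of_real E * fourier g n"
    using fourier_add[of "\<lambda>x. \<Sum>k\<in>{-int l..int l}. cnj (wh k) * g (x + of_int k * \<alpha>)" "\<lambda>x. \<Sum>j\<in>{-int d..int d}. vh j * (g x * ee j x)" n]
      fourier_sum[of "{-int l..int l}" "\<lambda>k x. cnj (wh k) * g (x + of_int k * \<alpha>)" n]
      fourier_sum[of "{-int d..int d}" "\<lambda>j x. vh j * (g x * ee j x)" n]
    by (simp add: fourier_cmult continuous_intros cont)
  moreover have "(\<Sum>k\<in>{-int l..int l}. cnj (wh k) * fourier (\<lambda>x. g (x + of_int k * \<alpha>)) n) = trig_poly wh l (of_int n * \<alpha>) * fourier g n"
  proof -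
    have "trig_poly wh l (of_int n * \<alpha>) = cnj (trig_poly wh l (of_int n * \<alpha>))"
      using w_real by (simp add: Reals_cnj_iff)
    also have "\<dots> = (\<Sum>k\<in>{-int l..int l}. cnj (wh k) * ee (- n) (of_int k * \<alpha>))"
      by (simp add: trig_poly_ee cnj_ee ee_of_int) (simp add: mult.commute)
    finally show ?thesis
      by (simp add: fourier_shift per cont sum_distrib_left sum_distrib_right mult_ac)
  qed
  ultimately show ?thesis by (simp add: fourier_mult_ee add.commute)
qed

lemma index_mat_mult_sum:
  assumes "A \<in> carrier_mat n m" "B \<in> carrier_mat m k" "i < n" "j < k"
  shows "(A * B) $$ (i,j) = (\<Sum>r<m. A $$ (i,r) * B $$ (r,j))"
  using assms by (simp add: scalar_prod_def lessThan_atLeast0)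

text \<open>The rows of the transfer matrix below the first only move entries down by one, so each
  column of \<open>H\<close> samples a single scalar function along the orbit. Row
  \<open>l - 1\<close> is the reference because it holds the value at site 0 of the state with sites
  \<open>l - 1\<close>, ..., \<open>- l\<close>.\<close>

lemma transfer_mat_conjugacy_shift:
  assumes H: "\<And>x. H x \<in> carrier_mat (2*l) k"
    and eq: "\<And>x. transfer_mat wh l q E x * H x = H (x + \<alpha>)" and "j < k" "i < 2*l"
  shows "H x $$ (i,j) = H (x + of_int (int l - 1 - int i) * \<alpha>) $$ (l - 1, j)"
proof -
  have T: "transfer_mat wh l q E x \<in> carrier_mat (2*l) (2*l)" for x by (simp add: transfer_mat_def)
  have step: "H (x + \<alpha>) $$ (Suc i, j) = H x $$ (i, j)" if "Suc i < 2*l" for i x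
  proof -
    have "H (x + \<alpha>) $$ (Suc i, j) = (\<Sum>r<2*l. transfer_mat wh l q E x $$ (Suc i, r) * H x $$ (r,j))"
      using index_mat_mult_sum[OF T H that \<open>j < k\<close>] eq by metis
    also have "\<dots> = (\<Sum>r<2*l. if r = i then H x $$ (r,j) else 0)"
      using that by (intro sum.cong) (auto simp: transfer_mat_def)
    finally show ?thesis using that by simp
  qed
  have top: "H (x + of_nat i * \<alpha>) $$ (i, j) = H x $$ (0, j)" if "i < 2*l" for i x
    using that
  proof (induction i)
    case (Suc i)
    then show ?case using step[of i "x + of_nat i * \<alpha>"] by (simp add: algebra_simps)
  qed simp
  have "l - 1 < 2*l" using \<open>i < 2*l\<close> by auto
  moreover have "real (l - 1) = real l - 1" using \<open>i < 2*l\<close> by (simp add: of_nat_diff)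
  ultimately show ?thesis
    using top[OF \<open>i < 2*l\<close>, of "x - of_nat i * \<alpha>"] top[of "l - 1" "x - of_nat i * \<alpha>"]
    by (simp add: algebra_simps)
qed

text \<open>The first row, multiplied by \<open>wh (int l)\<close>, is the eigenvalue equation
  solved for its leading term; by the shift property every entry of the column is a value of
  \<open>g\<close>.\<close>

lemma transfer_mat_conjugacy_equation:
  assumes H: "\<And>x. H x \<in> carrier_mat (2*l) k"
    and eq: "\<And>x. transfer_mat wh l q E x * H x = H (x + \<alpha>)" and "j < k" and l: "l \<ge> 1" and wl: "wh (int l) \<noteq> 0"
  defines "g \<equiv> \<lambda>x. H x $$ (l - 1, j)"
  shows "(\<Sum>k\<in>{-int l..int l}. wh k * g (x + of_int k * \<alpha>)) + q x * g x = of_real E * g x"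
proof -
  have T: "transfer_mat wh l q E x \<in> carrier_mat (2*l) (2*l)" for x by (simp add: transfer_mat_def)
  note shift = transfer_mat_conjugacy_shift[OF H eq \<open>j < k\<close>]
  have "g (x + of_int (int l) * \<alpha>) = H (x + \<alpha>) $$ (0, j)"
    using shift[of 0 "x + \<alpha>"] l by (simp add: g_def algebra_simps)
  also have "\<dots> = (\<Sum>r<2*l. transfer_mat wh l q E x $$ (0, r) * H x $$ (r,j))"
    unfolding eq [symmetric] by (rule index_mat_mult_sum[OF T H _ \<open>j < k\<close>]) (use l in simp)
  also have "\<dots> = (\<Sum>r<2*l. transfer_mat wh l q E x $$ (0, r) * g (x + of_int (int l - 1 - int r) * \<alpha>))"
  proof (rule sum.cong)
    fix r assume "r \<in> {..<2*l}"
    then have "H x $$ (r, j) = g (x + of_int (int l - 1 - int r) * \<alpha>)"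
      unfolding g_def by (intro shift) simp
    then show "transfer_mat wh l q E x $$ (0, r) * H x $$ (r, j) =
        transfer_mat wh l q E x $$ (0, r) * g (x + of_int (int l - 1 - int r) * \<alpha>)" by (simp only:)
  qed simp
  finally have top: "g (x + of_int (int l) * \<alpha>) =
      (\<Sum>r<2*l. transfer_mat wh l q E x $$ (0, r) * g (x + of_int (int l - 1 - int r) * \<alpha>))" .
  have "wh (int l) * transfer_mat wh l q E x $$ (0, r) =
      (if int l - 1 - int r = 0 then of_real E - q x - wh 0 else - wh (int l - 1 - int r))" if "r < 2*l" for r
    using that l wl by (auto simp: transfer_mat_def)
  then have "wh (int l) * g (x + of_int (int l) * \<alpha>) =
      (\<Sum>r<2*l. (if int l - 1 - int r = 0 then of_real E - q x - wh 0 else - wh (int l - 1 - int r)) * g (x + of_int (int l - 1 - int r) * \<alpha>))"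
    unfolding top sum_distrib_left mult.assoc [symmetric] by (intro sum.cong) auto
  also have "\<dots> = (\<Sum>k\<in>{-int l..int l - 1}. (if k = 0 then of_real E - q x - wh 0 else - wh k) * g (x + of_int k * \<alpha>))"
    by (rule sum.reindex_bij_witness[of _ "\<lambda>k. nat (int l - 1 - k)" "\<lambda>r. int l - 1 - int r"]) auto
  also have "\<dots> = (\<Sum>k\<in>{-int l..int l - 1}. (if k = 0 then (of_real E - q x) * g x else 0) - wh k * g (x + of_int k * \<alpha>))"
    by (intro sum.cong) (auto simp: algebra_simps)
  also have "\<dots> = (of_real E - q x) * g x - (\<Sum>k\<in>{-int l..int l - 1}. wh k * g (x + of_int k * \<alpha>))"
    using l by (simp add: sum_subtractf)
  finally have "wh (int l) * g (x + of_int (int l) * \<alpha>) + (\<Sum>k\<in>{-int l..int l - 1}. wh k * g (x + of_int k * \<alpha>)) = (of_real E - q x) * g x"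
    by (simp add: algebra_simps)
  moreover have "{-int l..int l} = insert (int l) {-int l..int l - 1}" by auto
  ultimately show ?thesis by (simp add: algebra_simps)
qed

section \<open>The form preserved by the transfer matrices\<close>

lemma S_mat_carrier [simp]: "S_mat ph d \<in> carrier_mat (2*d) (2*d)"
  unfolding S_mat_def C_mat_def adjoint_mat_def
  by (rule carrier_matI) auto

text \<open>The sesquilinear form p* S q, conjugate-linear in the first argument.\<close>

definition sform :: "complex mat \<Rightarrow> complex Matrix.vec \<Rightarrow> complex Matrix.vec \<Rightarrow> complex" where
  "sform S p q = (\<Sum>i<dim_vec p. cnj (p $ i) * (S *\<^sub>v q) $ i)"

text \<open>The contribution of the block \<open>C_mat\<close>: lower half of \<open>u\<close>,
  conjugated, against upper half of \<open>w\<close>. Antisymmetrised with conjugation it is the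
  Wronskian of the finite-range operator. The arguments are sequences rather than vectors so that
  they can be shifted by one site.\<close>

definition pform :: "(int \<Rightarrow> complex) \<Rightarrow> nat \<Rightarrow> (nat \<Rightarrow> complex) \<Rightarrow> (nat \<Rightarrow> complex) \<Rightarrow> complex" where
  "pform ph d u w = (\<Sum>i<d. \<Sum>j<d. if i \<le> j then cnj (u (d + i)) * ph (int d - int j + int i) * w j else 0)"

lemma sum_two_blocks: "(\<Sum>i<2*d. f i) = (\<Sum>i<d. f i) + (\<Sum>i<d. f (d + i))" for f :: "nat \<Rightarrow> complex"
proof -
  have "(\<Sum>i<2*d. f i) = sum f {0..<d} + sum f {d..<2*d}"
    by (simp add: lessThan_atLeast0 sum.atLeastLessThan_concat)
  moreover have "sum f {d..<2*d} = (\<Sum>i<d. f (d + i))"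
    using sum.shift_bounds_nat_ivl[of f 0 d d] by (simp add: lessThan_atLeast0 add.commute mult_2)
  ultimately show ?thesis by (simp add: lessThan_atLeast0)
qed

lemma sform_S_mat:
  assumes p: "p \<in> carrier_vec (2*d)" and q: "q \<in> carrier_vec (2*d)"
  shows "sform (S_mat ph d) p q = pform ph d (\<lambda>i. p $ i) (\<lambda>i. q $ i) - cnj (pform ph d (\<lambda>i. q $ i) (\<lambda>i. p $ i))"
proof -
  have dims: "dim_row (S_mat ph d) = 2*d" "dim_col (S_mat ph d) = 2*d"
    using S_mat_carrier by blast+
  have Sq: "(S_mat ph d *\<^sub>v q) $ i = (\<Sum>j<2*d. S_mat ph d $$ (i,j) * q $ j)" if "i < 2*d" for i
    using that q dims by (simp add: scalar_prod_def lessThan_atLeast0)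
  have top: "(S_mat ph d *\<^sub>v q) $ i = (\<Sum>j<d. if j \<le> i then - cnj (ph (int d - int i + int j)) * q $ (d + j) else 0)" if "i < d" for i
    unfolding Sq[OF trans_less_add1[OF that, of d, folded mult_2]] sum_two_blocks
    using that by (auto simp: S_mat_def C_mat_def adjoint_mat_def intro!: sum.cong)
  have bot: "(S_mat ph d *\<^sub>v q) $ (d + i) = (\<Sum>j<d. if i \<le> j then ph (int d - int j + int i) * q $ j else 0)" if "i < d" for i
  proof -
    have "d + i < 2*d" using that by simp
    show ?thesis unfolding Sq[OF \<open>d + i < 2*d\<close>] sum_two_blocks
      using that by (auto simp: S_mat_def C_mat_def adjoint_mat_def intro!: sum.cong)
  qed
  have "sform (S_mat ph d) p q = (\<Sum>i<d. cnj (p $ i) * (S_mat ph d *\<^sub>v q) $ i) + (\<Sum>i<d. cnj (p $ (d + i)) * (S_mat ph d *\<^sub>v q) $ (d + i))"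
    using p by (simp add: sform_def sum_two_blocks)
  also have "(\<Sum>i<d. cnj (p $ (d + i)) * (S_mat ph d *\<^sub>v q) $ (d + i)) = pform ph d (\<lambda>i. p $ i) (\<lambda>i. q $ i)"
    unfolding pform_def by (intro sum.cong) (auto simp: bot sum_distrib_left mult.assoc intro!: sum.cong)
  also have "(\<Sum>i<d. cnj (p $ i) * (S_mat ph d *\<^sub>v q) $ i) = 
     (\<Sum>i<d. \<Sum>j<d. - (if j \<le> i then cnj (ph (int d - int i + int j)) * q $ (d + j) * cnj (p $ i) else 0))"
    by (intro sum.cong) (auto simp: top sum_distrib_left intro!: sum.cong)
  also have "\<dots> = - cnj (pform ph d (\<lambda>i. q $ i) (\<lambda>i. p $ i))"
    unfolding pform_def by (subst sum.swap) (simp add: sum_negf if_distrib[of cnj] mult_ac cong: if_cong)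
  finally show ?thesis by simp
qed

(* With x the sequence of 2 d + 1 consecutive values, both Wronskians are sums over the triangle I <= J <= d with one edge removed. *)
lemma pform_step:
  assumes d: "d \<ge> 1"
  shows "pform ph d (\<lambda>i. x i) (\<lambda>i. y i) - pform ph d (\<lambda>i. x (Suc i)) (\<lambda>i. y (Suc i)) =
    cnj (x d) * (\<Sum>j\<le>d. ph (int d - int j) * y j) - y d * (\<Sum>i\<le>d. cnj (x (d + i)) * ph (int i))"
proof -
  define t where "t i j = (if i \<le> j then cnj (x (d + i)) * ph (int d - int j + int i) * y j else 0)" for i j
  have "pform ph d (\<lambda>i. x i) (\<lambda>i. y i) = (\<Sum>i<d. \<Sum>j<d. t i j)"
    by (simp add: pform_def t_def)
  moreover have inner: "pform ph d (\<lambda>i. x (Suc i)) (\<lambda>i. y (Suc i)) = (\<Sum>i<d. \<Sum>j<d. t (Suc i) (Suc j))"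
  proof -
    have "int d - int (Suc j) + int (Suc i) = int d - int j + int i" for i j by simp
    then show ?thesis unfolding pform_def t_def by (simp only: Suc_le_mono add_Suc_right cong: if_cong)
  qed
  moreover have "(\<Sum>i<d. \<Sum>j<d. t i j) + (\<Sum>i<Suc d. t i d) = (\<Sum>i<Suc d. \<Sum>j<Suc d. t i j)"
    by (simp add: sum.distrib t_def)
  moreover have "\<dots> = (\<Sum>j<Suc d. t 0 j) + (\<Sum>i<d. \<Sum>j<d. t (Suc i) (Suc j))"
    by (simp only: sum.lessThan_Suc_shift[of _ d] sum.distrib) (simp add: t_def)
  moreover have "(\<Sum>j<Suc d. t 0 j) = cnj (x d) * (\<Sum>j\<le>d. ph (int d - int j) * y j)"
    by (simp add: t_def sum_distrib_left lessThan_Suc_atMost mult.assoc)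
  moreover have "(\<Sum>i<Suc d. t i d) = y d * (\<Sum>i\<le>d. cnj (x (d + i)) * ph (int i))"
    unfolding sum_distrib_left lessThan_Suc_atMost by (intro sum.cong) (auto simp: t_def mult_ac)
  moreover have "a - q = r - c" if "a + c = s" "s = r + q" for a c r q s :: complex
    using that by (simp add: algebra_simps)
  ultimately show ?thesis by metis
qed

lemma transfer_mat_carrier [simp]: "transfer_mat ph d q E x \<in> carrier_mat (2*d) (2*d)"
  by (simp add: transfer_mat_def)

text \<open>The index 0 belongs to both halves, whence the extra \<open>f 0\<close>. It is the
  source of the term \<open>ph 0\<close> in the conservation of the form.\<close>

lemma sum_neg_nonneg_split:
  fixes f :: "int \<Rightarrow> complex"
  shows "(\<Sum>k\<in>{-int d..int d}. f k) + f 0 = (\<Sum>j\<le>d. f (int d - int j)) + (\<Sum>j\<le>d. f (- int j))"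
proof -
  have 1: "(\<Sum>j\<le>d. f (int d - int j)) = (\<Sum>k\<in>{0..int d}. f k)"
    by (rule sum.reindex_bij_witness[of _ "\<lambda>k. nat (int d - k)" "\<lambda>j. int d - int j"]) auto
  have 2: "(\<Sum>j\<le>d. f (- int j)) = (\<Sum>k\<in>{-int d..0}. f k)"
    by (rule sum.reindex_bij_witness[of _ "\<lambda>k. nat (- k)" "\<lambda>j. - int j"]) auto
  have "{0..int d} \<union> {-int d..0} = {-int d..int d}" "{0..int d} \<inter> {-int d..0} = {0}" by auto
  then show ?thesis
    unfolding 1 2 using sum.union_inter[of "{0..int d}" "{-int d..0}" f] by simp
qed

text \<open>\<open>x\<close> is a window of 2 d + 1 consecutive values, newest first: the new state
  occupies the indices 0 to 2 d - 1, the old one the indices 1 to 2 d, and index d is the site at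
  which the eigenvalue equation is centred.\<close>

lemma transfer_mat_vec:
  fixes E t :: real and q :: "real \<Rightarrow> complex"
  assumes U: "U \<in> carrier_vec (2*d)" and d: "d \<ge> 1" and ph: "ph (int d) \<noteq> 0"
  defines "x \<equiv> \<lambda>i. case i of 0 \<Rightarrow> (transfer_mat ph d q E t *\<^sub>v U) $ 0 | Suc i \<Rightarrow> U $ i"
  shows "\<And>i. i < 2*d \<Longrightarrow> (transfer_mat ph d q E t *\<^sub>v U) $ i = x i"
    and "(\<Sum>k\<in>{-int d..int d}. ph k * x (nat (int d - k))) = (of_real E - q t) * x d"
proof -
  let ?T = "transfer_mat ph d q E t"
  have row: "(?T *\<^sub>v U) $ i = (\<Sum>r<2*d. ?T $$ (i,r) * U $ r)" if "i < 2*d" for i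
    using that U by (simp add: scalar_prod_def lessThan_atLeast0 transfer_mat_def)
  show "(?T *\<^sub>v U) $ i = x i" if "i < 2*d" for i
  proof (cases i)
    case (Suc k)
    have "(?T *\<^sub>v U) $ i = (\<Sum>r<2*d. if r = k then U $ r else 0)"
      unfolding row[OF that] using that Suc by (intro sum.cong) (auto simp: transfer_mat_def)
    then show ?thesis using that Suc by (simp add: x_def)
  qed (simp add: x_def)
  have "ph (int d) * ?T $$ (0, r) = (if int d - 1 - int r = 0 then of_real E - q t - ph 0 else - ph (int d - 1 - int r))" if "r < 2*d" for r
    using that d ph by (auto simp: transfer_mat_def)
  then have "ph (int d) * x 0 = (\<Sum>r<2*d. (if int d - 1 - int r = 0 then of_real E - q t - ph 0 else - ph (int d - 1 - int r)) * x (Suc r))"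
    using d row[of 0] unfolding x_def by (simp add: sum_distrib_left mult.assoc [symmetric])
  also have "\<dots> = (\<Sum>k\<in>{-int d..int d - 1}. (if k = 0 then of_real E - q t - ph 0 else - ph k) * x (nat (int d - k)))"
  proof -
    have nat_1_add: "nat (1 + int r) = Suc r" for r by simp
    show ?thesis
      by (rule sum.reindex_bij_witness[of _ "\<lambda>k. nat (int d - 1 - k)" "\<lambda>r. int d - 1 - int r"])
         (auto simp: nat_diff_distrib' Suc_nat_eq_nat_zadd1 nat_1_add)
  qed
  also have "\<dots> = (\<Sum>k\<in>{-int d..int d - 1}. (if k = 0 then (of_real E - q t) * x d else 0) - ph k * x (nat (int d - k)))"
    by (intro sum.cong) (auto simp: algebra_simps)
  also have "\<dots> = (of_real E - q t) * x d - (\<Sum>k\<in>{-int d..int d - 1}. ph k * x (nat (int d - k)))"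
    using d by (simp add: sum_subtractf)
  finally have "ph (int d) * x 0 + (\<Sum>k\<in>{-int d..int d - 1}. ph k * x (nat (int d - k))) = (of_real E - q t) * x d"
    by (simp add: algebra_simps)
  moreover have "{-int d..int d} = insert (int d) {-int d..int d - 1}" by auto
  ultimately show "(\<Sum>k\<in>{-int d..int d}. ph k * x (nat (int d - k))) = (of_real E - q t) * x d" by simp
qed

text \<open>Discrete Green identity. By \<open>pform_step\<close> the difference of the new and the
  old form involves only the two half sums of the eigenvalue equation at the central site. They add
  up to \<open>c * y d\<close> and \<open>c * x d\<close> with
  \<open>c = of_real E - w t + ph 0\<close>, and the two products cancel because \<open>c\<close> is
  real.\<close>

lemma sform_transfer_mat:
  assumes p: "p \<in> carrier_vec (2*d)" and q: "q \<in> carrier_vec (2*d)" and d: "d \<ge> 1" and ph: "ph (int d) \<noteq> 0"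
    and sym: "\<And>k. \<bar>k\<bar> \<le> int d \<Longrightarrow> ph (- k) = cnj (ph k)" and w: "w t \<in> \<real>"
  shows "sform (S_mat ph d) (transfer_mat ph d w E t *\<^sub>v p) (transfer_mat ph d w E t *\<^sub>v q) = sform (S_mat ph d) p q"
proof -
  let ?T = "transfer_mat ph d w E t"
  define x where "x i = (case i of 0 \<Rightarrow> (?T *\<^sub>v p) $ 0 | Suc i \<Rightarrow> p $ i)" for i
  define y where "y i = (case i of 0 \<Rightarrow> (?T *\<^sub>v q) $ 0 | Suc i \<Rightarrow> q $ i)" for i
  note X = transfer_mat_vec[where U = p and d = d and ph = ph and q = w and E = E and t = t, OF p d ph, folded x_def]
    and Y = transfer_mat_vec[where U = q and d = d and ph = ph and q = w and E = E and t = t, OF q d ph, folded y_def]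
  have new: "pform ph d (\<lambda>i. (?T *\<^sub>v u) $ i) (\<lambda>i. (?T *\<^sub>v v) $ i) = pform ph d a b"
    if "\<And>i. i < 2*d \<Longrightarrow> (?T *\<^sub>v u) $ i = a i" "\<And>i. i < 2*d \<Longrightarrow> (?T *\<^sub>v v) $ i = b i" for u v a b
    unfolding pform_def by (intro sum.cong refl if_cong arg_cong2[where f = "(*)"] arg_cong[where f = cnj] that) auto
  have xy: "pform ph d (\<lambda>i. (?T *\<^sub>v p) $ i) (\<lambda>i. (?T *\<^sub>v q) $ i) = pform ph d x y"
    by (rule new) (use X(1) Y(1) in blast)+
  have yx: "pform ph d (\<lambda>i. (?T *\<^sub>v q) $ i) (\<lambda>i. (?T *\<^sub>v p) $ i) = pform ph d y x"
    by (rule new) (use X(1) Y(1) in blast)+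
  have old: "(\<lambda>i. x (Suc i)) = (\<lambda>i. p $ i)" "(\<lambda>i. y (Suc i)) = (\<lambda>i. q $ i)"
    by (simp_all add: x_def y_def)
  have carr: "?T *\<^sub>v p \<in> carrier_vec (2*d)" "?T *\<^sub>v q \<in> carrier_vec (2*d)"
    by (rule mult_mat_vec_carrier[OF transfer_mat_carrier], fact)+
  have main: "(\<Sum>j\<le>d. ph (int d - int j) * y j) + (\<Sum>i\<le>d. cnj (ph (int i)) * y (d + i)) = (of_real E - w t + ph 0) * y d"
    if "(\<Sum>k\<in>{-int d..int d}. ph k * y (nat (int d - k))) = (of_real E - w t) * y d" for y
  proof -
    have "(\<Sum>j\<le>d. ph (int d - int j) * y j) = (\<Sum>j\<le>d. ph (int d - int j) * y (nat (int d - (int d - int j))))" by simp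
    moreover have "(\<Sum>i\<le>d. cnj (ph (int i)) * y (d + i)) = (\<Sum>i\<le>d. ph (- int i) * y (nat (int d - (- int i))))"
      using sym by (intro sum.cong) (auto simp: nat_add_distrib nat_int_add)
    ultimately show ?thesis
      using sum_neg_nonneg_split[of "\<lambda>k. ph k * y (nat (int d - k))" d] that by (simp add: algebra_simps)
  qed
  have step: "pform ph d a b - pform ph d (\<lambda>i. a (Suc i)) (\<lambda>i. b (Suc i)) =
    cnj (a d) * (\<Sum>j\<le>d. ph (int d - int j) * b j) - b d * cnj (\<Sum>i\<le>d. cnj (ph (int i)) * a (d + i))" for a b
    using pform_step[OF d, of ph a b] by (simp add: mult.commute)
  let ?s = "\<lambda>a. \<Sum>j\<le>d. ph (int d - int j) * a j" and ?r = "\<lambda>a. \<Sum>i\<le>d. cnj (ph (int i)) * a (d + i)"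
  have "sform (S_mat ph d) (?T *\<^sub>v p) (?T *\<^sub>v q) - sform (S_mat ph d) p q =
    (pform ph d x y - pform ph d (\<lambda>i. x (Suc i)) (\<lambda>i. y (Suc i))) - cnj (pform ph d y x - pform ph d (\<lambda>i. y (Suc i)) (\<lambda>i. x (Suc i)))"
    unfolding sform_S_mat[OF carr] sform_S_mat[OF p q] xy yx old by simp
  also have "\<dots> = (cnj (x d) * ?s y - y d * cnj (?r x)) - cnj (cnj (y d) * ?s x - x d * cnj (?r y))"
    by (simp only: step)
  also have "\<dots> = cnj (x d) * (?s y + ?r y) - y d * cnj (?s x + ?r x)"
    by (simp only: complex_cnj_add complex_cnj_mult complex_cnj_diff complex_cnj_cnj) (simp add: algebra_simps)
  also have "\<dots> = 0"
    unfolding main[OF X(2)] main[OF Y(2)] using w sym[of 0] by (simp add: Reals_cnj_iff)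
  finally show ?thesis by simp
qed

text \<open>\<open>C_mat\<close> is triangular with all diagonal entries equal to
  \<open>ph (int d)\<close>, so it and its adjoint are invertible, and the inverse of the block
  antidiagonal matrix is again block antidiagonal.\<close>

lemma S_mat_left_inverse:
  assumes ph: "ph (int d) \<noteq> 0"
  obtains T where "T \<in> carrier_mat (2*d) (2*d)" "T * S_mat ph d = 1\<^sub>m (2*d)"
proof -
  define C where "C = C_mat ph d"
  have C: "C \<in> carrier_mat d d" by (simp add: C_def C_mat_def)
  have ex: "\<exists>T\<in>carrier_mat d d. T * M = 1\<^sub>m d" if "M \<in> carrier_mat d d" "det M \<noteq> 0" for M :: "complex mat"
    using det_non_zero_imp_unit[OF that, of "()"] unfolding Units_def ring_mat_def by auto
  have "det C = prod_list (diag_mat C)"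
    by (rule det_upper_triangular[OF _ C]) (auto simp: C_def C_mat_def)
  then have detC: "det C \<noteq> 0" using ph by (auto simp: diag_mat_def C_def C_mat_def prod_list_zero_iff)
  have "det (adjoint_mat C) = prod_list (diag_mat (adjoint_mat C))"
    by (rule det_lower_triangular[of d]) (auto simp: C_def C_mat_def adjoint_mat_def)
  then have detA: "det (adjoint_mat C) \<noteq> 0"
    using ph by (auto simp: diag_mat_def C_def C_mat_def adjoint_mat_def prod_list_zero_iff)
  have A: "adjoint_mat C \<in> carrier_mat d d" using C by (simp add: adjoint_mat_def)
  obtain T where T: "T \<in> carrier_mat d d" "T * C = 1\<^sub>m d" using ex[OF C detC] by blast
  obtain R where R: "R \<in> carrier_mat d d" "R * adjoint_mat C = 1\<^sub>m d" using ex[OF A detA] by blast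
  have uminus_zero_mat: "- 0\<^sub>m d d = (0\<^sub>m d d :: complex mat)" by (rule eq_matI) auto
  let ?I = "four_block_mat (0\<^sub>m d d) T (- R) (0\<^sub>m d d)"
  have "?I * S_mat ph d = four_block_mat (0\<^sub>m d d * 0\<^sub>m d d + T * C) (0\<^sub>m d d * (- adjoint_mat C) + T * 0\<^sub>m d d)
      (- R * 0\<^sub>m d d + 0\<^sub>m d d * C) (- R * (- adjoint_mat C) + 0\<^sub>m d d * 0\<^sub>m d d)"
    unfolding S_mat_def C_def[symmetric] using C A T R by (intro mult_four_block_mat) auto
  also have "\<dots> = four_block_mat (1\<^sub>m d) (0\<^sub>m d d) (0\<^sub>m d d) (1\<^sub>m d)"
    using C A T R by (simp add: uminus_mult_left_mat uminus_mult_right_mat uminus_zero_mat)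
  also have "\<dots> = 1\<^sub>m (2*d)" by (simp add: mult_2)
  finally have "?I * S_mat ph d = 1\<^sub>m (2*d)" .
  moreover have "?I \<in> carrier_mat (2*d) (2*d)" using T R by (intro carrier_matI) auto
  ultimately show ?thesis using that by blast
qed

section \<open>Norms, spans and isotropic subspaces\<close>

lemma vnorm_nonneg [simp]: "vnorm u \<ge> 0"
  by (simp add: vnorm_def sum_nonneg)

lemma vnorm_L2_set: "vnorm u = L2_set (\<lambda>i. cmod (u $ i)) {..<dim_vec u}"
  by (simp add: vnorm_def L2_set_def)

lemma cmod_le_vnorm: "i < dim_vec u \<Longrightarrow> cmod (u $ i) \<le> vnorm u"
  unfolding vnorm_L2_set by (rule member_le_L2_set) auto

lemma vnorm_le_sum: "vnorm u \<le> (\<Sum>i<dim_vec u. cmod (u $ i))"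
  unfolding vnorm_L2_set by (rule L2_set_le_sum) auto

lemma vnorm_smult: "vnorm (c \<cdot>\<^sub>v u) = cmod c * vnorm u"
  by (simp add: vnorm_def norm_mult power_mult_distrib sum_distrib_left [symmetric] real_sqrt_mult)

lemma vnorm_eq_0_iff: "u \<in> carrier_vec m \<Longrightarrow> vnorm u = 0 \<longleftrightarrow> u = 0\<^sub>v m"
  by (auto simp: vnorm_def sum_nonneg_eq_0_iff intro!: eq_vecI)

lemma vnorm_pos_iff: "u \<in> carrier_vec m \<Longrightarrow> 0 < vnorm u \<longleftrightarrow> u \<noteq> 0\<^sub>v m"
  using vnorm_eq_0_iff[of u m] vnorm_nonneg[of u] by linarith

lemma mult_mat_vec_index_sum:
  "M \<in> carrier_mat n m \<Longrightarrow> v \<in> carrier_vec m \<Longrightarrow> i < n \<Longrightarrow> (M *\<^sub>v v) $ i = (\<Sum>j<m. M $$ (i,j) * v $ j)"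
  by (simp add: scalar_prod_def lessThan_atLeast0)

lemma vnorm_mult_mat_vec_bound:
  assumes M: "M \<in> carrier_mat n m"
  obtains K where "K \<ge> 0" "\<And>v. v \<in> carrier_vec m \<Longrightarrow> vnorm (M *\<^sub>v v) \<le> K * vnorm v"
proof
  let ?K = "\<Sum>i<n. \<Sum>j<m. cmod (M $$ (i,j))"
  show "?K \<ge> 0" by (intro sum_nonneg) auto
  fix v :: "complex Matrix.vec" assume v: "v \<in> carrier_vec m"
  have "vnorm (M *\<^sub>v v) \<le> (\<Sum>i<n. cmod ((M *\<^sub>v v) $ i))"
    using vnorm_le_sum[of "M *\<^sub>v v"] M by simp
  also have "\<dots> \<le> (\<Sum>i<n. \<Sum>j<m. cmod (M $$ (i,j)) * vnorm v)"
  proof (intro sum_mono)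
    fix i assume "i \<in> {..<n}"
    then have "cmod ((M *\<^sub>v v) $ i) \<le> (\<Sum>j<m. cmod (M $$ (i,j) * v $ j))"
      using M v by (simp only: mult_mat_vec_index_sum[OF M v] lessThan_iff norm_sum)
    also have "\<dots> \<le> (\<Sum>j<m. cmod (M $$ (i,j)) * vnorm v)"
      using v cmod_le_vnorm[of _ v] by (intro sum_mono) (auto simp: norm_mult intro!: mult_left_mono)
    finally show "cmod ((M *\<^sub>v v) $ i) \<le> (\<Sum>j<m. cmod (M $$ (i,j)) * vnorm v)" .
  qed
  also have "\<dots> = ?K * vnorm v" by (simp add: sum_distrib_right)
  finally show "vnorm (M *\<^sub>v v) \<le> ?K * vnorm v" .
qed

lemma sform_bound:
  assumes S: "S \<in> carrier_mat m m"
  obtains K where "K \<ge> 0" "\<And>p q. p \<in> carrier_vec m \<Longrightarrow> q \<in> carrier_vec m \<Longrightarrow> cmod (sform S p q) \<le> K * (vnorm p * vnorm q)"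
proof -
  obtain K where K: "K \<ge> 0" "\<And>v. v \<in> carrier_vec m \<Longrightarrow> vnorm (S *\<^sub>v v) \<le> K * vnorm v"
    using vnorm_mult_mat_vec_bound[OF S] by blast
  have "cmod (sform S p q) \<le> (real m * K) * (vnorm p * vnorm q)" if p: "p \<in> carrier_vec m" and q: "q \<in> carrier_vec m" for p q
  proof -
    have "cmod (sform S p q) \<le> (\<Sum>i<m. cmod (cnj (p $ i) * (S *\<^sub>v q) $ i))"
      unfolding sform_def using p by (simp add: norm_sum)
    also have "\<dots> \<le> (\<Sum>i<m. vnorm p * (K * vnorm q))"
    proof (intro sum_mono)
      fix i assume "i \<in> {..<m}"
      then have "cmod (p $ i) \<le> vnorm p" "cmod ((S *\<^sub>v q) $ i) \<le> vnorm (S *\<^sub>v q)"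
        using cmod_le_vnorm[of i p] cmod_le_vnorm[of i "S *\<^sub>v q"] p S by auto
      then show "cmod (cnj (p $ i) * (S *\<^sub>v q) $ i) \<le> vnorm p * (K * vnorm q)"
        unfolding norm_mult using K(2)[OF q] by (intro mult_mono) auto
    qed
    finally show ?thesis by (simp add: mult_ac)
  qed
  then show ?thesis using that[of "real m * K"] K(1) by simp
qed

text \<open>This identity is how nondegeneracy gets used: \<open>S *\<^sub>v q\<close> is the
  partner of \<open>q\<close> whose pairing cannot vanish unless \<open>S *\<^sub>v q\<close>
  does.\<close>

lemma sform_self:
  "sform S (S *\<^sub>v q) q = of_real ((vnorm (S *\<^sub>v q))\<^sup>2)"
proof -
  have "(vnorm u)\<^sup>2 = (\<Sum>i<dim_vec u. (cmod (u $ i))\<^sup>2)" for u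
    by (simp add: vnorm_def sum_nonneg)
  then show ?thesis
    unfolding sform_def of_real_sum complex_norm_square by (simp only: of_real_sum complex_norm_square mult.commute)
qed

section \<open>Linear combinations and the dimension count\<close>

lemma lin_comb_carrier [simp]: "lin_comb m k b c \<in> carrier_vec m"
  by (simp add: lin_comb_def)

lemma lin_comb_index: "j < m \<Longrightarrow> lin_comb m k b c $ j = (\<Sum>i<k. c i * b i $ j)"
  by (simp add: lin_comb_def)

lemma lin_comb_Suc:
  "b k \<in> carrier_vec m \<Longrightarrow> lin_comb m (Suc k) b c = lin_comb m k b c + c k \<cdot>\<^sub>v b k"
  by (rule eq_vecI) (auto simp: lin_comb_index)

lemma smult_lin_comb: "a \<cdot>\<^sub>v lin_comb m k b c = lin_comb m k b (\<lambda>i. a * c i)"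
  by (rule eq_vecI) (auto simp: lin_comb_def sum_distrib_left mult.assoc)

lemma mult_mat_vec_lin_comb:
  assumes M: "M \<in> carrier_mat n m" and b: "\<And>i. i < k \<Longrightarrow> b i \<in> carrier_vec m" and "j < n"
  shows "(M *\<^sub>v lin_comb m k b c) $ j = (\<Sum>i<k. c i * (M *\<^sub>v b i) $ j)"
proof -
  have "(M *\<^sub>v lin_comb m k b c) $ j = (\<Sum>r<m. \<Sum>i<k. M $$ (j,r) * (c i * b i $ r))"
    by (simp add: mult_mat_vec_index_sum[OF M lin_comb_carrier \<open>j < n\<close>] lin_comb_index sum_distrib_left)
  also have "\<dots> = (\<Sum>i<k. \<Sum>r<m. M $$ (j,r) * (c i * b i $ r))" by (rule sum.swap)
  also have "\<dots> = (\<Sum>i<k. c i * (M *\<^sub>v b i) $ j)"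
    by (intro sum.cong refl) (simp add: mult_mat_vec_index_sum[OF M b \<open>j < n\<close>] sum_distrib_left mult_ac)
  finally show ?thesis .
qed

lemma sform_lin_comb_zero:
  assumes S: "S \<in> carrier_mat m m" and b: "\<And>i. i < k \<Longrightarrow> b i \<in> carrier_vec m"
    and iso: "\<And>i j. i < k \<Longrightarrow> j < k \<Longrightarrow> sform S (b i) (b j) = 0"
  shows "sform S (lin_comb m k b e) (lin_comb m k b c) = 0"
proof -
  have "sform S (lin_comb m k b e) (lin_comb m k b c) =
      (\<Sum>r<m. \<Sum>i<k. \<Sum>j<k. cnj (e i) * c j * (cnj (b i $ r) * (S *\<^sub>v b j) $ r))"
  proof -
    have "cnj (lin_comb m k b e $ r) * (S *\<^sub>v lin_comb m k b c) $ r =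
        (\<Sum>i<k. \<Sum>j<k. cnj (e i) * c j * (cnj (b i $ r) * (S *\<^sub>v b j) $ r))" if "r < m" for r
      by (simp only: lin_comb_index[OF that] mult_mat_vec_lin_comb[where b = b, OF S b that] cnj_sum complex_cnj_mult sum_product)
         (simp only: mult_ac)
    then show ?thesis by (simp add: sform_def carrier_vecD[OF lin_comb_carrier] del: index_mult_mat_vec)
  qed
  also have "\<dots> = (\<Sum>i<k. \<Sum>r<m. \<Sum>j<k. cnj (e i) * c j * (cnj (b i $ r) * (S *\<^sub>v b j) $ r))"
    by (rule sum.swap)
  also have "\<dots> = (\<Sum>i<k. \<Sum>j<k. \<Sum>r<m. cnj (e i) * c j * (cnj (b i $ r) * (S *\<^sub>v b j) $ r))"
    by (rule sum.cong[OF refl], rule sum.swap)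
  also have "\<dots> = (\<Sum>i<k. \<Sum>j<k. cnj (e i) * c j * sform S (b i) (b j))"
    by (intro sum.cong refl) (simp add: sform_def sum_distrib_left carrier_vecD[OF b])
  finally show ?thesis by (simp add: iso)
qed

text \<open>Padding with zero rows gives a square matrix whose last row is zero; its transpose kills
  the last unit vector, so the determinant vanishes and the kernel is nontrivial.\<close>

lemma underdetermined_system:
  assumes M: "M \<in> carrier_mat n m" and "n < m"
  obtains z :: "'a :: field Matrix.vec" where "z \<in> carrier_vec m" "z \<noteq> 0\<^sub>v m" "M *\<^sub>v z = 0\<^sub>v n"
proof -
  define P where "P = Matrix.mat m m (\<lambda>(i,j). if i < n then M $$ (i,j) else 0)"
  have P: "P \<in> carrier_mat m m" by (simp add: P_def)
  have "P\<^sup>T *\<^sub>v unit_vec m (m - 1) = 0\<^sub>v m"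
    using P \<open>n < m\<close> by (intro eq_vecI) (auto simp: P_def)
  moreover have "unit_vec m (m - 1) \<noteq> (0\<^sub>v m :: 'a Matrix.vec)"
    using \<open>n < m\<close> by (metis diff_less index_unit_vec(1) index_zero_vec(1) less_nat_zero_code not_gr_zero zero_less_one zero_neq_one)
  ultimately have "Determinant.det P\<^sup>T = 0"
    using det_0_iff_vec_prod_zero_field[of "P\<^sup>T" m] P by (metis transpose_carrier_mat unit_vec_carrier)
  then have "Determinant.det P = 0" using det_transpose[OF P] by simp
  then obtain z where z: "z \<in> carrier_vec m" "z \<noteq> 0\<^sub>v m" "P *\<^sub>v z = 0\<^sub>v m"
    using det_0_iff_vec_prod_zero_field[OF P] by auto
  have "M *\<^sub>v z = 0\<^sub>v n"
  proof (rule eq_vecI)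
    fix i assume "i < dim_vec (0\<^sub>v n :: 'a Matrix.vec)"
    then have i: "i < n" by simp
    then have "Matrix.row M i = Matrix.row P i" using M \<open>n < m\<close> by (intro eq_vecI) (auto simp: P_def)
    then have "(M *\<^sub>v z) $ i = (P *\<^sub>v z) $ i" using i M P \<open>n < m\<close> by simp
    then show "(M *\<^sub>v z) $ i = 0\<^sub>v n $ i" using z(3) i \<open>n < m\<close> by simp
  qed (use M in simp)
  with z that show ?thesis by blast
qed

text \<open>The vectors \<open>b i\<close> and \<open>S *\<^sub>v b i\<close> number 2 (d + 1), so
  they are dependent in dimension 2 d. The two halves of the relation are the coefficients
  \<open>e\<close> (negated) and \<open>c\<close>. If the \<open>c\<close>-combination were zero, so
  would be its image, and independence would kill both halves.\<close>

lemma independent_image_meets_span: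
  assumes S: "S \<in> carrier_mat (2*d) (2*d)" and b: "\<And>i. i < d + 1 \<Longrightarrow> b i \<in> carrier_vec (2*d)"
    and indep: "\<And>c. lin_comb (2*d) (d+1) b c = 0\<^sub>v (2*d) \<Longrightarrow> \<forall>i<d+1. c i = 0"
  obtains c e where "lin_comb (2*d) (d+1) b c \<noteq> 0\<^sub>v (2*d)"
    "S *\<^sub>v lin_comb (2*d) (d+1) b c = lin_comb (2*d) (d+1) b e"
proof -
  define M where "M = Matrix.mat (2*d) (2*(d+1)) (\<lambda>(r,i). if i < d + 1 then b i $ r else (S *\<^sub>v b (i - (d+1))) $ r)"
  have M: "M \<in> carrier_mat (2*d) (2*(d+1))" by (simp add: M_def)
  obtain z where z: "z \<in> carrier_vec (2*(d+1))" "z \<noteq> 0\<^sub>v (2*(d+1))" "M *\<^sub>v z = 0\<^sub>v (2*d)"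
    using underdetermined_system[OF M] by auto
  define c e where "c i = z $ (d + 1 + i)" and "e i = - z $ i" for i
  have eq: "S *\<^sub>v lin_comb (2*d) (d+1) b c = lin_comb (2*d) (d+1) b e"
  proof (rule eq_vecI)
    fix r assume "r < dim_vec (lin_comb (2*d) (d+1) b e)"
    then have r: "r < 2*d" by (simp add: lin_comb_def)
    have "0 = (M *\<^sub>v z) $ r" using z r by simp
    also have "\<dots> = (\<Sum>i<2*(d+1). M $$ (r,i) * z $ i)" by (rule mult_mat_vec_index_sum[OF M z(1) r])
    also have "\<dots> = (\<Sum>i<d+1. - (e i * b i $ r)) + (\<Sum>i<d+1. c i * (S *\<^sub>v b i) $ r)"
      unfolding sum_two_blocks using r by (intro arg_cong2[where f = "(+)"] sum.cong) (auto simp: M_def c_def e_def)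
    also have "\<dots> = - lin_comb (2*d) (d+1) b e $ r + (S *\<^sub>v lin_comb (2*d) (d+1) b c) $ r"
    proof -
      have "(S *\<^sub>v lin_comb (2*d) (d+1) b c) $ r = (\<Sum>i<d+1. c i * (S *\<^sub>v b i) $ r)"
        by (rule mult_mat_vec_lin_comb[OF S b r])
      then show ?thesis unfolding lin_comb_index[OF r] sum_negf by (simp only:)
    qed
    finally show "(S *\<^sub>v lin_comb (2*d) (d+1) b c) $ r = lin_comb (2*d) (d+1) b e $ r" by simp
  qed (use S in \<open>simp add: lin_comb_def\<close>)
  moreover have "lin_comb (2*d) (d+1) b c \<noteq> 0\<^sub>v (2*d)"
  proof
    assume 0: "lin_comb (2*d) (d+1) b c = 0\<^sub>v (2*d)"
    have "S *\<^sub>v 0\<^sub>v (2*d) = 0\<^sub>v (2*d)" using S by auto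
    with 0 eq have "lin_comb (2*d) (d+1) b e = 0\<^sub>v (2*d)" by simp
    with 0 indep have ce: "\<forall>i<d+1. c i = 0" "\<forall>i<d+1. e i = 0" by blast+
    have "z $ i = 0" if "i < 2*(d+1)" for i
    proof (cases "i < d + 1")
      case True then show ?thesis using ce(2) by (simp add: e_def)
    next
      case False then show ?thesis using ce(1) that by (auto simp: c_def dest: spec[of _ "i - (d+1)"])
    qed
    then have "z = 0\<^sub>v (2*(d+1))" using z(1) by (intro eq_vecI) auto
    with z(2) show False ..
  qed
  ultimately show ?thesis using that by blast
qed

text \<open>The span contains some nonzero \<open>q\<close> along with \<open>S *\<^sub>v q\<close>;
  isotropy makes their pairing, the squared norm of \<open>S *\<^sub>v q\<close>, vanish, and
  \<open>T\<close> then forces \<open>q\<close> to be zero.\<close>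

lemma no_isotropic_family_above_half_dim:
  assumes S: "S \<in> carrier_mat (2*d) (2*d)" and T: "T \<in> carrier_mat (2*d) (2*d)" "T * S = 1\<^sub>m (2*d)"
    and b: "\<And>i. i < d + 1 \<Longrightarrow> b i \<in> carrier_vec (2*d)"
    and indep: "\<And>c. lin_comb (2*d) (d+1) b c = 0\<^sub>v (2*d) \<Longrightarrow> \<forall>i<d+1. c i = 0"
    and iso: "\<And>i j. i < d + 1 \<Longrightarrow> j < d + 1 \<Longrightarrow> sform S (b i) (b j) = 0"
  shows False
proof -
  obtain c e where ce: "lin_comb (2*d) (d+1) b c \<noteq> 0\<^sub>v (2*d)"
    "S *\<^sub>v lin_comb (2*d) (d+1) b c = lin_comb (2*d) (d+1) b e"
    using independent_image_meets_span[where b = b, OF S b indep] by blast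
  let ?q = "lin_comb (2*d) (d+1) b c"
  have Sq: "S *\<^sub>v ?q \<in> carrier_vec (2*d)" using S by auto
  have "sform S (S *\<^sub>v ?q) ?q = 0"
    unfolding ce(2) using sform_lin_comb_zero[where b = b, OF S b iso] by simp
  then have "vnorm (S *\<^sub>v ?q) = 0" using sform_self[of S ?q] by simp
  then have "S *\<^sub>v ?q = 0\<^sub>v (2*d)" using vnorm_eq_0_iff[OF Sq] by simp
  then have "T *\<^sub>v (S *\<^sub>v ?q) = 0\<^sub>v (2*d)" using T by auto
  then have "?q = 0\<^sub>v (2*d)" using assoc_mult_mat_vec[OF T(1) S, of ?q] T(2) by simp
  with ce(1) show False ..
qed

section \<open>Uniform domination by compactness\<close>

lemma bounded_coefficients_subsequence:
  fixes c :: "nat \<Rightarrow> nat \<Rightarrow> complex"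
  assumes "\<And>n i. i < k \<Longrightarrow> cmod (c n i) \<le> 1"
  shows "\<exists>r l. strict_mono (r :: nat \<Rightarrow> nat) \<and> (\<forall>i<k. (\<lambda>n. c (r n) i) \<longlonglongrightarrow> l i)"
  using assms
proof (induction k)
  case 0
  show ?case by (intro exI[of _ id]) (auto simp: strict_mono_def)
next
  case (Suc k)
  then obtain r l where r: "strict_mono (r :: nat \<Rightarrow> nat)" "\<forall>i<k. (\<lambda>n. c (r n) i) \<longlonglongrightarrow> l i"
    by (metis less_Suc_eq)
  have "\<forall>n. c (r n) k \<in> cball 0 1" using Suc.prems by simp
  then obtain z s where s: "strict_mono s" "((\<lambda>n. c (r n) k) \<circ> s) \<longlonglongrightarrow> z"
    using compact_cball[of "0::complex" 1] unfolding compact_def by metis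
  have "(\<lambda>n. c ((r \<circ> s) n) i) \<longlonglongrightarrow> (l(k := z)) i" if "i < Suc k" for i
  proof (cases "i = k")
    case True then show ?thesis using s(2) by (simp add: o_def)
  next
    case False
    then have "((\<lambda>n. c (r n) i) \<circ> s) \<longlonglongrightarrow> l i" using r(2) s(1) that by (intro LIMSEQ_subseq_LIMSEQ) auto
    then show ?thesis using False by (simp add: o_def)
  qed
  then show ?case using strict_mono_o[OF r(1) s(1)] by blast
qed

lemma tendsto_vnorm:
  assumes "\<And>n. u n \<in> carrier_vec m" "u0 \<in> carrier_vec m" "\<And>j. j < m \<Longrightarrow> (\<lambda>n. u n $ j) \<longlonglongrightarrow> u0 $ j"
  shows "(\<lambda>n. vnorm (u n)) \<longlonglongrightarrow> vnorm u0"
  unfolding vnorm_def carrier_vecD[OF assms(1)] carrier_vecD[OF assms(2)]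
  by (intro tendsto_intros assms(3)) simp

lemma tendsto_mult_mat_vec:
  fixes M :: "nat \<Rightarrow> complex mat"
  assumes M: "\<And>n. M n \<in> carrier_mat m m" "M0 \<in> carrier_mat m m"
    and lim: "\<And>i j. i < m \<Longrightarrow> j < m \<Longrightarrow> (\<lambda>n. M n $$ (i,j)) \<longlonglongrightarrow> M0 $$ (i,j)"
    and u: "\<And>n. u n \<in> carrier_vec m" "u0 \<in> carrier_vec m" "\<And>j. j < m \<Longrightarrow> (\<lambda>n. u n $ j) \<longlonglongrightarrow> u0 $ j"
    and "i < m"
  shows "(\<lambda>n. (M n *\<^sub>v u n) $ i) \<longlonglongrightarrow> (M0 *\<^sub>v u0) $ i"
  unfolding mult_mat_vec_index_sum[OF M(1) u(1) \<open>i < m\<close>] mult_mat_vec_index_sum[OF M(2) u(2) \<open>i < m\<close>]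
  by (rule tendsto_sum, rule tendsto_mult) (use lim u(3) \<open>i < m\<close> in auto)

lemma cont_subspaces_basis:
  assumes "cont_subspaces m k F"
  obtains b where "is_basis m k b (F x)"
  using assms unfolding cont_subspaces_def by (metis abs_zero cancel_comm_monoid_add_class.diff_cancel)

lemma cont_subspaces_carrier:
  assumes "cont_subspaces m k F" "u \<in> F x"
  shows "u \<in> carrier_vec m"
  using cont_subspaces_basis[OF assms(1), of x] assms(2) unfolding is_basis_def
  by (smt (verit) lin_comb_carrier mem_Collect_eq)

lemma cont_subspaces_smult:
  assumes "cont_subspaces m k F" "u \<in> F x"
  shows "a \<cdot>\<^sub>v u \<in> F x"
proof -
  obtain b where b: "is_basis m k b (F x)" using cont_subspaces_basis[OF assms(1)] .
  then obtain c where "u = lin_comb m k b c" using assms(2) unfolding is_basis_def by auto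
  then have "a \<cdot>\<^sub>v u = lin_comb m k b (\<lambda>i. a * c i)" by (simp add: smult_lin_comb)
  then show ?thesis using b unfolding is_basis_def by blast
qed

(* Rescaling the vectors so that their coordinates in a local continuous frame have l1-norm 1 makes the coordinates subconverge to a nonzero limit. *)
lemma cont_subspaces_limit:
  assumes F: "cont_subspaces m k F" and X: "X \<longlonglongrightarrow> x0"
    and u: "\<And>n. u n \<in> F (X n)" "\<And>n. u n \<noteq> 0\<^sub>v m"
  obtains r s u0 where "strict_mono (r :: nat \<Rightarrow> nat)" "\<And>n. s n \<noteq> 0" "u0 \<in> F x0" "u0 \<noteq> 0\<^sub>v m"
    "\<And>j. j < m \<Longrightarrow> (\<lambda>n. (s n \<cdot>\<^sub>v u (r n)) $ j) \<longlonglongrightarrow> u0 $ j"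
proof -
  obtain e b where e: "e > 0" and b: "\<And>x. \<bar>x - x0\<bar> < e \<Longrightarrow> is_basis m k (\<lambda>i. b i x) (F x)"
    and bc: "\<And>i j. i < k \<Longrightarrow> j < m \<Longrightarrow> continuous_on {x0 - e<..<x0 + e} (\<lambda>x. b i x $ j)"
    using F unfolding cont_subspaces_def by metis
  obtain n0 where n0: "\<And>n. n \<ge> n0 \<Longrightarrow> \<bar>X n - x0\<bar> < e"
    using LIMSEQ_D[OF X \<open>e > 0\<close>] by auto
  define Y where "Y n = X (n + n0)" for n
  have Y: "\<bar>Y n - x0\<bar> < e" for n using n0 by (simp add: Y_def)
  have "\<exists>c. u (n + n0) = lin_comb m k (\<lambda>i. b i (Y n)) c" for n
    using b[OF Y[of n]] u(1)[of "n + n0"] unfolding is_basis_def Y_def by blast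
  then obtain c where c: "\<And>n. u (n + n0) = lin_comb m k (\<lambda>i. b i (Y n)) (c n)" by metis
  define t where "t n = (\<Sum>i<k. cmod (c n i))" for n
  have t: "t n > 0" for n
  proof (rule ccontr)
    assume "\<not> t n > 0"
    then have "t n = 0" using sum_nonneg[of "{..<k}" "\<lambda>i. cmod (c n i)"] by (force simp: t_def)
    then have "\<forall>i<k. c n i = 0" by (simp add: t_def sum_nonneg_eq_0_iff)
    then have "u (n + n0) = 0\<^sub>v m" unfolding c by (intro eq_vecI) (auto simp: lin_comb_def)
    then show False using u(2) by blast
  qed
  define a where "a n i = c n i / of_real (t n)" for n i
  have norm_a: "cmod (a n i) = cmod (c n i) / t n" for n i using t[of n] by (simp add: a_def norm_divide)
  have a1: "cmod (a n i) \<le> 1" if "i < k" for n i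
    using t[of n] that member_le_sum[of i "{..<k}" "\<lambda>i. cmod (c n i)"] by (simp add: norm_a t_def)
  have asum: "(\<Sum>i<k. cmod (a n i)) = 1" for n
    using t[of n] by (simp add: norm_a sum_divide_distrib [symmetric]) (simp add: t_def)
  obtain r l where r: "strict_mono (r :: nat \<Rightarrow> nat)" "\<And>i. i < k \<Longrightarrow> (\<lambda>n. a (r n) i) \<longlonglongrightarrow> l i"
    using bounded_coefficients_subsequence[of k a] a1 by metis
  \<comment> \<open>The normalisation survives in the limit, so \<open>l\<close> is not zero;
    independence of the frame at \<open>x0\<close> then makes the limit vector nonzero.\<close>
  have "(\<lambda>n. \<Sum>i<k. cmod (a (r n) i)) \<longlonglongrightarrow> (\<Sum>i<k. cmod (l i))"
    by (intro tendsto_intros r) auto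
  then have lsum: "(\<Sum>i<k. cmod (l i)) = 1"
    using asum LIMSEQ_unique[OF _ tendsto_const[of 1]] by simp
  let ?u0 = "lin_comb m k (\<lambda>i. b i x0) l"
  have b0: "is_basis m k (\<lambda>i. b i x0) (F x0)" using b[of x0] e by simp
  have u0: "?u0 \<in> F x0" using b0 unfolding is_basis_def by blast
  have "?u0 \<noteq> 0\<^sub>v m"
  proof
    assume "?u0 = 0\<^sub>v m"
    then have "\<forall>i<k. l i = 0" using b0 unfolding is_basis_def by blast
    then show False using lsum by simp
  qed
  moreover have "(\<lambda>n. (of_real (1 / t (r n)) \<cdot>\<^sub>v u (r n + n0)) $ j) \<longlonglongrightarrow> ?u0 $ j" if "j < m" for j
  proof -
    have eq: "(of_real (1 / t (r n)) \<cdot>\<^sub>v u (r n + n0)) $ j = (\<Sum>i<k. a (r n) i * b i (Y (r n)) $ j)" for n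
      unfolding c smult_lin_comb lin_comb_index[OF that] by (simp add: a_def field_simps)
    have "Y \<longlonglongrightarrow> x0" unfolding Y_def using X by (rule LIMSEQ_ignore_initial_segment)
    then have Yr: "(\<lambda>n. Y (r n)) \<longlonglongrightarrow> x0" using LIMSEQ_subseq_LIMSEQ[OF _ r(1)] by (force simp: o_def)
    have "(\<lambda>n. b i (Y (r n)) $ j) \<longlonglongrightarrow> b i x0 $ j" if "i < k" for i
      by (rule continuous_on_tendsto_compose[OF bc[OF that \<open>j < m\<close>] Yr]) (use e Y in \<open>auto simp: abs_less_iff algebra_simps\<close>)
    then show ?thesis
      unfolding eq lin_comb_index[OF that] by (intro tendsto_intros r) auto
  qed
  moreover have "strict_mono (\<lambda>n. r n + n0)" using r(1) by (simp add: strict_mono_def)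
  moreover have "of_real (1 / t (r n)) \<noteq> (0::complex)" for n using t[of "r n"] by simp
  ultimately show ?thesis using that[of "\<lambda>n. r n + n0" "\<lambda>n. of_real (1 / t (r n))" ?u0] u0 by blast
qed

text \<open>Compactness of one period and of the directions in both bundles: violations with the
  factors \<open>1 - 1 / real (Suc n)\<close> would, after rescaling, subconverge to nonzero vectors
  over some \<open>x0\<close> that contradict the strict inequality there. Products instead of
  quotients make the conclusion homogeneous in each vector and valid for zero vectors too.\<close>

lemma uniform_domination:
  fixes B :: "real \<Rightarrow> complex mat"
  assumes B: "\<And>x. B x \<in> carrier_mat m m" and Bcont: "\<And>i j. i < m \<Longrightarrow> j < m \<Longrightarrow> continuous_on UNIV (\<lambda>x. B x $$ (i,j))"
    and Bper: "\<And>x. B (x + 1) = B x"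
    and P: "cont_subspaces m k P" "\<And>x. P (x + 1) = P x" and Q: "cont_subspaces m k' Q" "\<And>x. Q (x + 1) = Q x"
    and dom: "\<And>x u u'. u \<in> P x \<Longrightarrow> u' \<in> Q x \<Longrightarrow> vnorm u = 1 \<Longrightarrow> vnorm u' = 1 \<Longrightarrow> vnorm (B x *\<^sub>v u) > vnorm (B x *\<^sub>v u')"
  obtains \<rho> where "0 \<le> \<rho>" "\<rho> < 1" "\<And>x u u'. u \<in> P x \<Longrightarrow> u' \<in> Q x \<Longrightarrow>
      vnorm (B x *\<^sub>v u') * vnorm u \<le> \<rho> * (vnorm (B x *\<^sub>v u) * vnorm u')"
proof -
  have carrP: "u \<in> carrier_vec m" if "u \<in> P x" for u x using cont_subspaces_carrier[OF P(1) that] .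
  have carrQ: "u \<in> carrier_vec m" if "u \<in> Q x" for u x using cont_subspaces_carrier[OF Q(1) that] .
  have Bsmult: "B x *\<^sub>v (a \<cdot>\<^sub>v u) = a \<cdot>\<^sub>v (B x *\<^sub>v u)" if "u \<in> carrier_vec m" for x a u
    using mult_mat_vec[OF B that] .
  have dom': "vnorm (B x *\<^sub>v u') * vnorm u < vnorm (B x *\<^sub>v u) * vnorm u'"
    if "u \<in> P x" "u' \<in> Q x" "u \<noteq> 0\<^sub>v m" "u' \<noteq> 0\<^sub>v m" for x u u'
  proof -
    have c: "u \<in> carrier_vec m" "u' \<in> carrier_vec m" using that carrP carrQ by auto
    have pos: "vnorm u > 0" "vnorm u' > 0" using that vnorm_pos_iff c by auto
    let ?v = "of_real (1 / vnorm u) \<cdot>\<^sub>v u" and ?v' = "of_real (1 / vnorm u') \<cdot>\<^sub>v u'"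
    have "vnorm (B x *\<^sub>v ?v') < vnorm (B x *\<^sub>v ?v)"
      using pos that by (intro dom cont_subspaces_smult[OF P(1)] cont_subspaces_smult[OF Q(1)])
        (auto simp: vnorm_smult norm_divide)
    then show ?thesis using pos by (simp add: Bsmult c vnorm_smult norm_divide field_simps)
  qed
  have "\<exists>n::nat. \<forall>x u u'. u \<in> P x \<longrightarrow> u' \<in> Q x \<longrightarrow>
      vnorm (B x *\<^sub>v u') * vnorm u \<le> (1 - 1 / real (Suc n)) * (vnorm (B x *\<^sub>v u) * vnorm u')"
  proof (rule ccontr)
    assume "\<not> ?thesis"
    then have ex: "\<forall>n. \<exists>x u u'. u \<in> P x \<and> u' \<in> Q x \<and>
      (1 - 1 / real (Suc n)) * (vnorm (B x *\<^sub>v u) * vnorm u') < vnorm (B x *\<^sub>v u') * vnorm u"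
      by (simp add: not_le)
    have per: "f (frac x) = f x" if "\<And>x. f (x + 1) = f x" for f :: "real \<Rightarrow> 'b" and x
      using periodic_of_int[of f "frac x" "\<lfloor>x\<rfloor>", OF that] by (simp add: frac_def)
    have "\<exists>x u u'. x \<in> {0..1} \<and> u \<in> P x \<and> u' \<in> Q x \<and>
      (1 - 1 / real (Suc n)) * (vnorm (B x *\<^sub>v u) * vnorm u') < vnorm (B x *\<^sub>v u') * vnorm u" for n
    proof -
      obtain x u u' where "u \<in> P x" "u' \<in> Q x"
        "(1 - 1 / real (Suc n)) * (vnorm (B x *\<^sub>v u) * vnorm u') < vnorm (B x *\<^sub>v u') * vnorm u" using ex by blast
      then show ?thesis
        using frac_lt_1[of x] per[of P, OF P(2)] per[of Q, OF Q(2)] per[of B, OF Bper]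
        by (intro exI[of _ "frac x"] exI[of _ u] exI[of _ u']) (auto simp: less_imp_le)
    qed
    then obtain X u u' where X: "\<And>n. X n \<in> {0..1}" and u: "\<And>n. u n \<in> P (X n)" "\<And>n. u' n \<in> Q (X n)"
      and less: "\<And>n. (1 - 1 / real (Suc n)) * (vnorm (B (X n) *\<^sub>v u n) * vnorm (u' n)) < vnorm (B (X n) *\<^sub>v u' n) * vnorm (u n)"
      by metis
    \<comment> \<open>The strict violation makes its right-hand side positive, which excludes zero
      vectors, as the passage to limiting directions requires.\<close>
    have nz: "u n \<noteq> 0\<^sub>v m" "u' n \<noteq> 0\<^sub>v m" for n
    proof -
      have "0 \<le> (1 - 1 / real (Suc n)) * (vnorm (B (X n) *\<^sub>v u n) * vnorm (u' n))" by (intro mult_nonneg_nonneg) auto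
      then have pos: "0 < vnorm (B (X n) *\<^sub>v u' n) * vnorm (u n)" using less[of n] by linarith
      then show "u n \<noteq> 0\<^sub>v m" by (auto simp: vnorm_def)
      show "u' n \<noteq> 0\<^sub>v m"
      proof
        assume "u' n = 0\<^sub>v m"
        then have "B (X n) *\<^sub>v u' n = 0\<^sub>v m" using B[of "X n"] by auto
        with pos show False by (simp add: vnorm_def)
      qed
    qed
    obtain x0 r1 where r1: "strict_mono r1" "(X \<circ> r1) \<longlonglongrightarrow> x0"
      using X compact_Icc[of 0 "1::real"] unfolding compact_def by blast
    obtain r2 s2 u0 where r2: "strict_mono r2" "\<And>n. s2 n \<noteq> 0" "u0 \<in> P x0" "u0 \<noteq> 0\<^sub>v m"
      "\<And>j. j < m \<Longrightarrow> (\<lambda>n. (s2 n \<cdot>\<^sub>v (u \<circ> r1) (r2 n)) $ j) \<longlonglongrightarrow> u0 $ j"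
      by (rule cont_subspaces_limit[OF P(1) r1(2), of "u \<circ> r1"]) (use u nz in auto)
    have lim2: "(X \<circ> r1 \<circ> r2) \<longlonglongrightarrow> x0" using LIMSEQ_subseq_LIMSEQ[OF r1(2) r2(1)] .
    obtain r3 s3 v0 where r3: "strict_mono r3" "\<And>n. s3 n \<noteq> 0" "v0 \<in> Q x0" "v0 \<noteq> 0\<^sub>v m"
      "\<And>j. j < m \<Longrightarrow> (\<lambda>n. (s3 n \<cdot>\<^sub>v (u' \<circ> r1 \<circ> r2) (r3 n)) $ j) \<longlonglongrightarrow> v0 $ j"
      by (rule cont_subspaces_limit[OF Q(1) lim2, of "u' \<circ> r1 \<circ> r2"]) (use u nz in auto)
    define R where "R n = r1 (r2 (r3 n))" for n
    have R: "strict_mono R" using r1(1) r2(1) r3(1) by (simp add: R_def strict_mono_def)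
    define U where "U n = s2 (r3 n) \<cdot>\<^sub>v u (R n)" for n
    define V where "V n = s3 n \<cdot>\<^sub>v u' (R n)" for n
    have cU: "u n \<in> carrier_vec m" "u' n \<in> carrier_vec m" for n using u carrP carrQ by blast+
    have c: "U n \<in> carrier_vec m" "V n \<in> carrier_vec m" for n using cU by (auto simp: U_def V_def)
    have c0: "u0 \<in> carrier_vec m" "v0 \<in> carrier_vec m" using r2(3) r3(3) carrP carrQ by blast+
    have limU: "(\<lambda>n. U n $ j) \<longlonglongrightarrow> u0 $ j" if "j < m" for j
      using LIMSEQ_subseq_LIMSEQ[OF r2(5)[OF that] r3(1)] by (simp add: U_def R_def o_def)
    have limV: "(\<lambda>n. V n $ j) \<longlonglongrightarrow> v0 $ j" if "j < m" for j
      using r3(5)[OF that] by (simp add: V_def R_def o_def)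
    have limX: "(\<lambda>n. X (R n)) \<longlonglongrightarrow> x0"
      using LIMSEQ_subseq_LIMSEQ[OF lim2 r3(1)] by (simp add: R_def o_def)
    have limB: "(\<lambda>n. B (X (R n)) $$ (i,j)) \<longlonglongrightarrow> B x0 $$ (i,j)" if "i < m" "j < m" for i j
      by (rule continuous_on_tendsto_compose[OF Bcont[OF that] limX]) auto
    have BU: "(\<lambda>n. vnorm (B (X (R n)) *\<^sub>v U n)) \<longlonglongrightarrow> vnorm (B x0 *\<^sub>v u0)"
      by (rule tendsto_vnorm[where m = m]) (auto intro!: tendsto_mult_mat_vec[where m = m] mult_mat_vec_carrier B c c0 limB limU simp del: index_mult_mat_vec)
    have BV: "(\<lambda>n. vnorm (B (X (R n)) *\<^sub>v V n)) \<longlonglongrightarrow> vnorm (B x0 *\<^sub>v v0)"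
      by (rule tendsto_vnorm[where m = m]) (auto intro!: tendsto_mult_mat_vec[where m = m] mult_mat_vec_carrier B c c0 limB limV simp del: index_mult_mat_vec)
    have nU: "(\<lambda>n. vnorm (U n)) \<longlonglongrightarrow> vnorm u0" and nV: "(\<lambda>n. vnorm (V n)) \<longlonglongrightarrow> vnorm v0"
      by (auto intro!: tendsto_vnorm[where m = m] c c0 limU limV)
    have "(\<lambda>n. 1 / real (Suc (R n))) \<longlonglongrightarrow> 0"
      using LIMSEQ_subseq_LIMSEQ[OF LIMSEQ_inverse_real_of_nat R] by (simp add: o_def inverse_eq_divide)
    then have "(\<lambda>n. (1 - 1 / real (Suc (R n))) * (vnorm (B (X (R n)) *\<^sub>v U n) * vnorm (V n)))
       \<longlonglongrightarrow> (1 - 0) * (vnorm (B x0 *\<^sub>v u0) * vnorm v0)"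
      by (intro tendsto_intros BU nV)
    moreover have "(\<lambda>n. vnorm (B (X (R n)) *\<^sub>v V n) * vnorm (U n)) \<longlonglongrightarrow> vnorm (B x0 *\<^sub>v v0) * vnorm u0"
      by (intro tendsto_intros BV nU)
    \<comment> \<open>Each side is homogeneous of degree one in either vector, so the violation
      survives the rescaling by \<open>s2\<close> and \<open>s3\<close>.\<close>
    moreover have "(1 - 1 / real (Suc (R n))) * (vnorm (B (X (R n)) *\<^sub>v U n) * vnorm (V n)) \<le> vnorm (B (X (R n)) *\<^sub>v V n) * vnorm (U n)" for n
    proof -
      have "cmod (s2 (r3 n)) * cmod (s3 n) * ((1 - 1 / real (Suc (R n))) * (vnorm (B (X (R n)) *\<^sub>v u (R n)) * vnorm (u' (R n))))
         \<le> cmod (s2 (r3 n)) * cmod (s3 n) * (vnorm (B (X (R n)) *\<^sub>v u' (R n)) * vnorm (u (R n)))"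
        using less[of "R n"] by (intro mult_left_mono) auto
      then show ?thesis
        unfolding U_def V_def Bsmult[OF cU(1)] Bsmult[OF cU(2)] vnorm_smult by (simp only: mult_ac)
    qed
    ultimately have "(1 - 0) * (vnorm (B x0 *\<^sub>v u0) * vnorm v0) \<le> vnorm (B x0 *\<^sub>v v0) * vnorm u0"
      by (blast intro: LIMSEQ_le)
    then show False using dom'[OF r2(3) r3(3) r2(4) r3(4)] by simp
  qed
  then obtain n where n: "\<forall>x u u'. u \<in> P x \<longrightarrow> u' \<in> Q x \<longrightarrow>
      vnorm (B x *\<^sub>v u') * vnorm u \<le> (1 - 1 / real (Suc n)) * (vnorm (B x *\<^sub>v u) * vnorm u')" ..
  show ?thesis by (rule that[of "1 - 1 / real (Suc n)"]) (use n in auto)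
qed

section \<open>Expansion of the dominating bundle\<close>

context
  fixes m :: nat and \<alpha> :: real and A :: "real \<Rightarrow> complex mat"
  assumes A: "\<And>x. A x \<in> carrier_mat m m"
begin

lemma cocycle_iter_carrier: "cocycle_iter m \<alpha> A n x \<in> carrier_mat m m"
  by (induction n) (auto intro: mult_carrier_mat A)

lemma cocycle_iter_vec_carrier: "u \<in> carrier_vec m \<Longrightarrow> cocycle_iter m \<alpha> A n x *\<^sub>v u \<in> carrier_vec m"
  by (rule mult_mat_vec_carrier[OF cocycle_iter_carrier])

lemma cocycle_iter_Suc_vec:
  "u \<in> carrier_vec m \<Longrightarrow> cocycle_iter m \<alpha> A (Suc n) x *\<^sub>v u = A (x + real n * \<alpha>) *\<^sub>v (cocycle_iter m \<alpha> A n x *\<^sub>v u)"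
  using assoc_mult_mat_vec[OF A cocycle_iter_carrier] by simp

lemma cocycle_iter_add_vec:
  assumes "u \<in> carrier_vec m"
  shows "cocycle_iter m \<alpha> A (n' + n) x *\<^sub>v u = cocycle_iter m \<alpha> A n' (x + real n * \<alpha>) *\<^sub>v (cocycle_iter m \<alpha> A n x *\<^sub>v u)"
proof (induction n')
  case 0
  show ?case using one_mult_mat_vec[OF cocycle_iter_vec_carrier[OF assms]] by simp
next
  case (Suc n')
  show ?case
    using Suc cocycle_iter_Suc_vec[OF assms, of "n' + n" x]
      cocycle_iter_Suc_vec[OF cocycle_iter_vec_carrier[OF assms], of n' "x + real n * \<alpha>" n x]
    by (simp add: algebra_simps del: cocycle_iter.simps)
qed

lemma cocycle_iter_orbit:
  assumes "\<And>n. U n \<in> carrier_vec m" "\<And>n. A (of_int n * \<alpha>) *\<^sub>v U n = U (n + 1)"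
  shows "cocycle_iter m \<alpha> A n (of_int k * \<alpha>) *\<^sub>v U k = U (k + int n)"
proof (induction n)
  case 0
  show ?case using one_mult_mat_vec[OF assms(1)[of k]] by simp
next
  case (Suc n)
  have "of_int k * \<alpha> + real n * \<alpha> = of_int (k + int n) * \<alpha>" by (simp add: algebra_simps)
  then show ?case
    using cocycle_iter_Suc_vec[OF assms(1)[of k], of n] Suc assms(2)[of "k + int n"]
    by (simp add: add_ac del: cocycle_iter.simps)
qed

lemma cocycle_iter_image:
  assumes F: "\<And>x. F x \<subseteq> carrier_vec m" "\<And>x. (\<lambda>u. A x *\<^sub>v u) ` F x = F (x + \<alpha>)"
  shows "(\<lambda>u. cocycle_iter m \<alpha> A n x *\<^sub>v u) ` F x = F (x + real n * \<alpha>)"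
proof (induction n)
  case 0
  have "1\<^sub>m m *\<^sub>v u = u" if "u \<in> F x" for u using that F(1)[of x] one_mult_mat_vec by blast
  then show ?case by auto
next
  case (Suc n)
  have "(\<lambda>u. cocycle_iter m \<alpha> A (Suc n) x *\<^sub>v u) ` F x
      = (\<lambda>u. A (x + real n * \<alpha>) *\<^sub>v u) ` ((\<lambda>u. cocycle_iter m \<alpha> A n x *\<^sub>v u) ` F x)"
    unfolding image_image using F(1)[of x] by (intro image_cong refl cocycle_iter_Suc_vec) auto
  also have "\<dots> = F (x + real (Suc n) * \<alpha>)"
    unfolding Suc F(2) by (simp add: algebra_simps)
  finally show ?case .
qed

lemma cocycle_iter_periodic: "(\<And>x. A (x + 1) = A x) \<Longrightarrow> cocycle_iter m \<alpha> A n (x + 1) = cocycle_iter m \<alpha> A n x"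
proof (induction n)
  case (Suc n)
  then show ?case using Suc.prems[of "x + real n * \<alpha>"] by (simp add: add_ac)
qed simp

lemma cocycle_iter_continuous:
  assumes "\<And>i j. i < m \<Longrightarrow> j < m \<Longrightarrow> continuous_on UNIV (\<lambda>x. A x $$ (i,j))"
  shows "i < m \<Longrightarrow> j < m \<Longrightarrow> continuous_on UNIV (\<lambda>x. cocycle_iter m \<alpha> A n x $$ (i,j))"
proof (induction n arbitrary: i j)
  case (Suc n)
  have "cocycle_iter m \<alpha> A (Suc n) x $$ (i,j) = (\<Sum>r<m. A (x + real n * \<alpha>) $$ (i,r) * cocycle_iter m \<alpha> A n x $$ (r,j))" for x
    using Suc.prems cocycle_iter_carrier[of n x] A[of "x + real n * \<alpha>"]
    by (simp add: scalar_prod_def lessThan_atLeast0)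
  moreover have "continuous_on UNIV (\<lambda>x. A (x + real n * \<alpha>) $$ (i,r))" if "r < m" for r
    by (rule continuous_on_compose2[OF assms[OF Suc.prems(1) that]]) (auto intro!: continuous_intros)
  ultimately show ?case
    using Suc by (auto intro!: continuous_on_sum continuous_on_mult)
qed (simp add: continuous_on_const)

text \<open>The inequality for one block of length \<open>N\<close> is chained over \<open>k\<close>
  blocks; invariance of both bundles allows it to be applied again to the images.\<close>

lemma cocycle_iter_domination:
  assumes P: "\<And>x. P x \<subseteq> carrier_vec m" "\<And>x. (\<lambda>u. A x *\<^sub>v u) ` P x = P (x + \<alpha>)"
    and Q: "\<And>x. Q x \<subseteq> carrier_vec m" "\<And>x. (\<lambda>u. A x *\<^sub>v u) ` Q x = Q (x + \<alpha>)"
    and \<rho>: "0 \<le> \<rho>" and dom: "\<And>x u u'. u \<in> P x \<Longrightarrow> u' \<in> Q x \<Longrightarrow>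
      vnorm (cocycle_iter m \<alpha> A N x *\<^sub>v u') * vnorm u \<le> \<rho> * (vnorm (cocycle_iter m \<alpha> A N x *\<^sub>v u) * vnorm u')"
    and u: "u \<in> P x" "u' \<in> Q x"
  shows "vnorm (cocycle_iter m \<alpha> A (k * N) x *\<^sub>v u') * vnorm u \<le> \<rho> ^ k * (vnorm (cocycle_iter m \<alpha> A (k * N) x *\<^sub>v u) * vnorm u')"
proof (induction k)
  case 0
  show ?case using u P(1) Q(1) one_mult_mat_vec by (simp add: subset_iff mult.commute)
next
  case (Suc k)
  let ?x = "x + real (k * N) * \<alpha>"
  define y where "y = cocycle_iter m \<alpha> A (k * N) x *\<^sub>v u"
  define y' where "y' = cocycle_iter m \<alpha> A (k * N) x *\<^sub>v u'"
  have mem: "y \<in> P ?x" "y' \<in> Q ?x"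
    using u cocycle_iter_image[OF P, of "k * N" x] cocycle_iter_image[OF Q, of "k * N" x] by (auto simp: y_def y'_def)
  have carr: "u \<in> carrier_vec m" "u' \<in> carrier_vec m" "y \<in> carrier_vec m" "y' \<in> carrier_vec m"
    using u mem P(1) Q(1) by blast+
  define z where "z = cocycle_iter m \<alpha> A N ?x *\<^sub>v y"
  define z' where "z' = cocycle_iter m \<alpha> A N ?x *\<^sub>v y'"
  have step: "cocycle_iter m \<alpha> A (Suc k * N) x *\<^sub>v u = z" "cocycle_iter m \<alpha> A (Suc k * N) x *\<^sub>v u' = z'"
    using cocycle_iter_add_vec[OF carr(1), of N "k * N" x] cocycle_iter_add_vec[OF carr(2), of N "k * N" x]
    by (simp_all add: y_def y'_def z_def z'_def)
  have IH: "vnorm y' * vnorm u \<le> \<rho> ^ k * (vnorm y * vnorm u')" using Suc by (simp add: y_def y'_def)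
  have d: "vnorm z' * vnorm y \<le> \<rho> * (vnorm z * vnorm y')" using dom[OF mem] by (simp add: z_def z'_def)
  show ?case
  \<comment> \<open>Chaining means cancelling \<open>vnorm y\<close>. If it is zero, the induction
    hypothesis leaves only \<open>y' = 0\<close> or \<open>u = 0\<close>, and the left-hand side
    vanishes.\<close>
  proof (cases "vnorm y = 0")
    case False
    then have pos: "vnorm y > 0" using vnorm_nonneg[of y] by linarith
    have "(vnorm z' * vnorm u) * vnorm y = (vnorm z' * vnorm y) * vnorm u" by simp
    also have "\<dots> \<le> (\<rho> * (vnorm z * vnorm y')) * vnorm u" by (intro mult_right_mono d) auto
    also have "\<dots> = (\<rho> * vnorm z) * (vnorm y' * vnorm u)" by simp
    also have "\<dots> \<le> (\<rho> * vnorm z) * (\<rho> ^ k * (vnorm y * vnorm u'))" by (intro mult_left_mono IH) (use \<rho> in auto)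
    also have "\<dots> = (\<rho> ^ Suc k * (vnorm z * vnorm u')) * vnorm y" by simp
    finally show ?thesis unfolding step using pos by simp
  next
    case True
    have "0 \<le> vnorm y' * vnorm u" by simp
    with IH True have "vnorm y' = 0 \<or> vnorm u = 0" by simp
    then have "vnorm z' * vnorm u = 0"
    proof
      assume "vnorm y' = 0"
      then have "y' = 0\<^sub>v m" using vnorm_eq_0_iff[OF carr(4)] by simp
      then have "z' = 0\<^sub>v m" using cocycle_iter_carrier[of N ?x] by (auto simp: z'_def)
      then show ?thesis by (simp add: vnorm_def)
    qed simp
    moreover have "0 \<le> \<rho> ^ Suc k * (vnorm z * vnorm u')" using \<rho> by (intro mult_nonneg_nonneg) auto
    ultimately show ?thesis unfolding step by linarith
  qed
qed

lemma cocycle_iter_sform: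
  assumes "\<And>x p q. p \<in> carrier_vec m \<Longrightarrow> q \<in> carrier_vec m \<Longrightarrow> sform S (A x *\<^sub>v p) (A x *\<^sub>v q) = sform S p q"
    and p: "p \<in> carrier_vec m" and q: "q \<in> carrier_vec m"
  shows "sform S (cocycle_iter m \<alpha> A n x *\<^sub>v p) (cocycle_iter m \<alpha> A n x *\<^sub>v q) = sform S p q"
proof (induction n)
  case 0
  show ?case using one_mult_mat_vec[OF p] one_mult_mat_vec[OF q] by simp
next
  case (Suc n)
  then show ?case
    unfolding cocycle_iter_Suc_vec[OF p] cocycle_iter_Suc_vec[OF q]
    using assms(1)[OF cocycle_iter_vec_carrier[OF p] cocycle_iter_vec_carrier[OF q]] by simp
qed

end

(* The dominated bundle has dimension d + 1 > d, so it contains vectors q and S q; their pairing is conserved, so their images cannot both be small, and domination makes the dominating bundle expand. *)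
lemma symplectic_domination_expands:
  assumes A: "\<And>x. A x \<in> carrier_mat (2*d) (2*d)" and S: "S \<in> carrier_mat (2*d) (2*d)"
    and T: "T \<in> carrier_mat (2*d) (2*d)" "T * S = 1\<^sub>m (2*d)"
    and inv: "\<And>x p q. p \<in> carrier_vec (2*d) \<Longrightarrow> q \<in> carrier_vec (2*d) \<Longrightarrow> sform S (A x *\<^sub>v p) (A x *\<^sub>v q) = sform S p q"
    and Q: "cont_subspaces (2*d) (d + 1) Q" and P: "\<And>x. P x \<subseteq> carrier_vec (2*d)"
    and dom: "\<And>x u u' k. u \<in> P x \<Longrightarrow> u' \<in> Q x \<Longrightarrow>
      vnorm (cocycle_iter (2*d) \<alpha> A (k * N) x *\<^sub>v u') * vnorm u \<le> \<rho> ^ k * (vnorm (cocycle_iter (2*d) \<alpha> A (k * N) x *\<^sub>v u) * vnorm u')"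
    and \<rho>: "0 \<le> \<rho>"
  obtains M where "M \<ge> 0" "\<And>x u k. u \<in> P x \<Longrightarrow> vnorm u \<le> M * \<rho> ^ k * vnorm (cocycle_iter (2*d) \<alpha> A (k * N) x *\<^sub>v u)"
proof -
  obtain K where K: "K \<ge> 0" "\<And>p q. p \<in> carrier_vec (2*d) \<Longrightarrow> q \<in> carrier_vec (2*d) \<Longrightarrow> cmod (sform S p q) \<le> K * (vnorm p * vnorm q)"
    using sform_bound[OF S] by blast
  obtain L where L: "L \<ge> 0" "\<And>v. v \<in> carrier_vec (2*d) \<Longrightarrow> vnorm (T *\<^sub>v v) \<le> L * vnorm v"
    using vnorm_mult_mat_vec_bound[OF T(1)] by blast
  \<comment> \<open>\<open>K\<close> bounds the form and \<open>L\<close> bounds \<open>T\<close>,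
    so \<open>vnorm q \<le> L * vnorm p\<close> for \<open>p = S *\<^sub>v q\<close>. The squared
    norm of \<open>p\<close> equals the conserved pairing of the images of \<open>p\<close> and
    \<open>q\<close>; domination bounds each of these images, giving \<open>\<rho> ^ k\<close>
    twice. Cancelling the squared norm of \<open>p\<close> and taking the root leaves the constant
    \<open>sqrt (K * L)\<close> and one factor \<open>\<rho> ^ k\<close>.\<close>
  have "vnorm u \<le> sqrt (K * L) * \<rho> ^ k * vnorm (cocycle_iter (2*d) \<alpha> A (k * N) x *\<^sub>v u)" if u: "u \<in> P x" for x u k
  proof -
    let ?C = "cocycle_iter (2*d) \<alpha> A (k * N) x"
    obtain b where b: "is_basis (2*d) (d + 1) b (Q x)" using cont_subspaces_basis[OF Q] .
    have b1: "\<And>i. i < d + 1 \<Longrightarrow> b i \<in> carrier_vec (2*d)"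
      and b2: "\<And>c. lin_comb (2*d) (d+1) b c = 0\<^sub>v (2*d) \<Longrightarrow> \<forall>i<d+1. c i = 0"
      using b unfolding is_basis_def by blast+
    obtain c e where ce: "lin_comb (2*d) (d+1) b c \<noteq> 0\<^sub>v (2*d)"
      "S *\<^sub>v lin_comb (2*d) (d+1) b c = lin_comb (2*d) (d+1) b e"
      using independent_image_meets_span[where b = b, OF S b1 b2] by blast
    define q where "q = lin_comb (2*d) (d+1) b c"
    define p where "p = S *\<^sub>v q"
    have qQ: "q \<in> Q x" "p \<in> Q x" using b ce(2) unfolding is_basis_def q_def p_def by blast+
    have carr: "q \<in> carrier_vec (2*d)" "p \<in> carrier_vec (2*d)"
      unfolding q_def p_def using S by auto
    have qp: "vnorm q \<le> L * vnorm p"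
      using L(2)[OF carr(2)] assoc_mult_mat_vec[OF T(1) S carr(1)] T(2) one_mult_mat_vec[OF carr(1)] by (simp add: p_def)
    have "vnorm q > 0" using ce(1) vnorm_pos_iff[OF carr(1)] by (simp add: q_def)
    then have "vnorm p \<noteq> 0" using qp by auto
    then have p_pos: "vnorm p > 0" using vnorm_nonneg[of p] by linarith
    define a where "a = vnorm (?C *\<^sub>v u)"
    have "(vnorm p)\<^sup>2 = cmod (sform S (?C *\<^sub>v p) (?C *\<^sub>v q))"
      using cocycle_iter_sform[OF A inv carr(2,1)] sform_self[of S q] by (simp add: p_def norm_power)
    also have "\<dots> \<le> K * (vnorm (?C *\<^sub>v p) * vnorm (?C *\<^sub>v q))"
      by (intro K(2) cocycle_iter_vec_carrier A carr)
    finally have "(vnorm p)\<^sup>2 * (vnorm u)\<^sup>2 \<le> K * (vnorm (?C *\<^sub>v p) * vnorm (?C *\<^sub>v q)) * (vnorm u)\<^sup>2"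
      by (rule mult_right_mono) simp
    also have "\<dots> = K * ((vnorm (?C *\<^sub>v p) * vnorm u) * (vnorm (?C *\<^sub>v q) * vnorm u))"
      by (simp add: power2_eq_square)
    also have "\<dots> \<le> K * ((\<rho> ^ k * (a * vnorm p)) * (\<rho> ^ k * (a * vnorm q)))"
      unfolding a_def by (intro mult_left_mono mult_mono dom u qQ K) (use \<rho> in auto)
    also have "\<dots> = (K * (\<rho> ^ k * a)\<^sup>2 * vnorm p) * vnorm q"
      by (simp add: power2_eq_square)
    also have "\<dots> \<le> (K * (\<rho> ^ k * a)\<^sup>2 * vnorm p) * (L * vnorm p)"
      by (intro mult_left_mono qp) (use K in auto)
    also have "\<dots> = (vnorm p)\<^sup>2 * (K * L * (\<rho> ^ k * a)\<^sup>2)" by (simp add: power2_eq_square)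
    finally have "(vnorm u)\<^sup>2 \<le> K * L * (\<rho> ^ k * a)\<^sup>2" using p_pos by simp
    then have "vnorm u \<le> sqrt (K * L * (\<rho> ^ k * a)\<^sup>2)" by (rule real_le_rsqrt)
    also have "\<dots> = sqrt (K * L) * \<rho> ^ k * a" using \<rho> by (simp add: real_sqrt_mult a_def)
    finally show ?thesis unfolding a_def .
  qed
  then show ?thesis using that[of "sqrt (K * L)"] K(1) L(1) by simp
qed

(* Vectors with a backward orbit tending to zero along multiples of N are pairwise orthogonal for the conserved form. *)
lemma symplectic_dominated_no_decaying_plane:
  fixes U V :: "int \<Rightarrow> complex Matrix.vec"
  assumes d: "d \<ge> 1" and A: "\<And>x. A x \<in> carrier_mat (2*d) (2*d)"
    and Acont: "\<And>i j. i < 2*d \<Longrightarrow> j < 2*d \<Longrightarrow> continuous_on UNIV (\<lambda>x. A x $$ (i,j))" and Aper: "\<And>x. A (x + 1) = A x"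
    and S: "S \<in> carrier_mat (2*d) (2*d)"
    and T: "T \<in> carrier_mat (2*d) (2*d)" "T * S = 1\<^sub>m (2*d)"
    and inv: "\<And>x p q. p \<in> carrier_vec (2*d) \<Longrightarrow> q \<in> carrier_vec (2*d) \<Longrightarrow> sform S (A x *\<^sub>v p) (A x *\<^sub>v q) = sform S p q"
    and dom: "dominated (2*d) (d - 1) \<alpha> A"
    and U: "\<And>n. U n \<in> carrier_vec (2*d)" "\<And>n. A (of_int n * \<alpha>) *\<^sub>v U n = U (n + 1)"
    and V: "\<And>n. V n \<in> carrier_vec (2*d)" "\<And>n. A (of_int n * \<alpha>) *\<^sub>v V n = V (n + 1)"
    and fwd: "(\<lambda>n. vnorm (U (int n))) \<longlonglongrightarrow> 0" "(\<lambda>n. vnorm (V (int n))) \<longlonglongrightarrow> 0"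
    and bwd: "(\<lambda>n. vnorm (U (- int n))) \<longlonglongrightarrow> 0" "(\<lambda>n. vnorm (V (- int n))) \<longlonglongrightarrow> 0"
    and indep: "\<And>a b. a \<cdot>\<^sub>v U 0 + b \<cdot>\<^sub>v V 0 = 0\<^sub>v (2*d) \<Longrightarrow> a = 0 \<and> b = 0"
  shows False
proof -
  have k: "2*d - (d - 1) = d + 1" using d by simp
  obtain P Q N where N: "N \<ge> 1" and P: "cont_subspaces (2*d) (d - 1) P" and Q: "cont_subspaces (2*d) (d + 1) Q"
    and per: "\<And>x. P (x + 1) = P x" "\<And>x. Q (x + 1) = Q x"
    and invP: "\<And>x. (\<lambda>u. A x *\<^sub>v u) ` P x = P (x + \<alpha>)" and invQ: "\<And>x. (\<lambda>u. A x *\<^sub>v u) ` Q x = Q (x + \<alpha>)"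
    and gap: "\<And>x u u'. u \<in> P x \<Longrightarrow> u' \<in> Q x \<Longrightarrow> vnorm u = 1 \<Longrightarrow> vnorm u' = 1 \<Longrightarrow>
      vnorm (cocycle_iter (2*d) \<alpha> A N x *\<^sub>v u) > vnorm (cocycle_iter (2*d) \<alpha> A N x *\<^sub>v u')"
    using dom unfolding dominated_def k by metis
  have cP: "P x \<subseteq> carrier_vec (2*d)" and cQ: "Q x \<subseteq> carrier_vec (2*d)" for x
    using cont_subspaces_carrier[OF P] cont_subspaces_carrier[OF Q] by blast+
  let ?C = "\<lambda>k x. cocycle_iter (2*d) \<alpha> A (k * N) x"
  obtain \<rho> where \<rho>: "0 \<le> \<rho>" "\<rho> < 1" and gap': "\<And>x u u'. u \<in> P x \<Longrightarrow> u' \<in> Q x \<Longrightarrow>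
      vnorm (cocycle_iter (2*d) \<alpha> A N x *\<^sub>v u') * vnorm u \<le> \<rho> * (vnorm (cocycle_iter (2*d) \<alpha> A N x *\<^sub>v u) * vnorm u')"
  proof (rule uniform_domination[where B = "cocycle_iter (2*d) \<alpha> A N" and m = "2*d" and k = "d - 1" and P = P and k' = "d + 1" and Q = Q])
    show "cocycle_iter (2*d) \<alpha> A N x \<in> carrier_mat (2*d) (2*d)" for x
      by (rule cocycle_iter_carrier) (rule A)
    show "continuous_on UNIV (\<lambda>x. cocycle_iter (2*d) \<alpha> A N x $$ (i,j))" if "i < 2*d" "j < 2*d" for i j
      by (rule cocycle_iter_continuous) (use A Acont that in auto)
    show "cocycle_iter (2*d) \<alpha> A N (x + 1) = cocycle_iter (2*d) \<alpha> A N x" for x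
      by (rule cocycle_iter_periodic[where m = "2*d"]) (use A Aper in auto)
  qed (use P Q per gap that in blast)+
  have gapk: "vnorm (?C k x *\<^sub>v u') * vnorm u \<le> \<rho> ^ k * (vnorm (?C k x *\<^sub>v u) * vnorm u')"
    if "u \<in> P x" "u' \<in> Q x" for x u u' k
    by (rule cocycle_iter_domination[where P = P and Q = Q]) (fact A cP invP cQ invQ \<rho>(1) gap' that)+
  obtain M where M: "M \<ge> 0" "\<And>x u k. u \<in> P x \<Longrightarrow> vnorm u \<le> M * \<rho> ^ k * vnorm (?C k x *\<^sub>v u)"
    by (rule symplectic_domination_expands[where A = A and d = d and Q = Q and P = P and \<alpha> = \<alpha> and N = N and \<rho> = \<rho> and S = S and T = T])
       (assumption | rule A S T inv Q cP gapk \<rho>(1) that)+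
  \<comment> \<open>Backward decay phrased through preimages: \<open>p\<close>, at base point 0, is
    reached from vectors over \<open>- real (k * N) * \<alpha>\<close> whose norms tend to zero.
    This covers vectors of \<open>P 0\<close> and bi-infinite orbits alike and avoids inverse
    cocycles.\<close>
  define null where "null p \<longleftrightarrow> (\<exists>Y. (\<forall>k. Y k \<in> carrier_vec (2*d) \<and> ?C k (- real (k * N) * \<alpha>) *\<^sub>v Y k = p) \<and> (\<lambda>k. vnorm (Y k)) \<longlonglongrightarrow> 0)" for p
  obtain K where K: "K \<ge> 0" "\<And>p q. p \<in> carrier_vec (2*d) \<Longrightarrow> q \<in> carrier_vec (2*d) \<Longrightarrow> cmod (sform S p q) \<le> K * (vnorm p * vnorm q)"
    using sform_bound[OF S] by blast
  have orth: "sform S p q = 0" if np: "null p" "null q" for p q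
  proof -
    obtain Y Z where Y: "\<And>k. Y k \<in> carrier_vec (2*d)" "\<And>k. ?C k (- real (k * N) * \<alpha>) *\<^sub>v Y k = p" "(\<lambda>k. vnorm (Y k)) \<longlonglongrightarrow> 0"
      and Z: "\<And>k. Z k \<in> carrier_vec (2*d)" "\<And>k. ?C k (- real (k * N) * \<alpha>) *\<^sub>v Z k = q" "(\<lambda>k. vnorm (Z k)) \<longlonglongrightarrow> 0"
      using np unfolding null_def by blast
    have "(\<lambda>k. K * (vnorm (Y k) * vnorm (Z k))) \<longlonglongrightarrow> K * (0 * 0)"
      by (intro tendsto_intros Y(3) Z(3))
    moreover have "cmod (sform S p q) \<le> K * (vnorm (Y k) * vnorm (Z k))" for k
      using K(2)[OF Y(1) Z(1), of k k] cocycle_iter_sform[where S = S and A = A and \<alpha> = \<alpha> and n = "k * N" and x = "- real (k * N) * \<alpha>", OF A inv Y(1)[of k] Z(1)[of k]] Y(2)[of k] Z(2)[of k] by simp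
    ultimately have "cmod (sform S p q) \<le> K * (0 * 0)" by (intro LIMSEQ_le_const) auto
    then show ?thesis by simp
  qed
  have nullP: "null f" if f: "f \<in> P 0" for f
  proof -
    \<comment> \<open>Invariance supplies a preimage inside the bundle \<open>P\<close>, where the
      expansion bound forces its norm below \<open>M * \<rho> ^ k * vnorm f\<close>.\<close>
    have "\<exists>Y. Y \<in> P (- real (k * N) * \<alpha>) \<and> ?C k (- real (k * N) * \<alpha>) *\<^sub>v Y = f" for k
    proof -
      have "f \<in> P (- real (k * N) * \<alpha> + real (k * N) * \<alpha>)" using f by simp
      then show ?thesis using cocycle_iter_image[where F = P, OF A cP invP, of "k * N" "- real (k * N) * \<alpha>"] by (metis imageE)
    qed
    then obtain Y where Y: "\<And>k. Y k \<in> P (- real (k * N) * \<alpha>)" "\<And>k. ?C k (- real (k * N) * \<alpha>) *\<^sub>v Y k = f" by metis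
    have "vnorm (Y k) \<le> M * \<rho> ^ k * vnorm f" for k using M(2)[OF Y(1), of k k] Y(2)[of k] by simp
    moreover have "(\<lambda>k. M * \<rho> ^ k * vnorm f) \<longlonglongrightarrow> M * 0 * vnorm f"
      using \<rho> by (intro tendsto_intros LIMSEQ_power_zero) auto
    ultimately have "(\<lambda>k. vnorm (Y k)) \<longlonglongrightarrow> 0"
      by (intro tendsto_sandwich[of "\<lambda>_. 0" "\<lambda>k. vnorm (Y k)" sequentially "\<lambda>k. M * \<rho> ^ k * vnorm f"]) auto
    then show ?thesis unfolding null_def using Y cP by (intro exI[of _ Y]) blast
  qed
  have sub: "filterlim (\<lambda>k. k * N) at_top sequentially"
    using N by (intro filterlim_subseq) (auto simp: strict_mono_def)
  have null_orbit: "null (W 0)" if W: "\<And>n. W n \<in> carrier_vec (2*d)" "\<And>n. A (of_int n * \<alpha>) *\<^sub>v W n = W (n + 1)"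
    and lim: "(\<lambda>n. vnorm (W (- int n))) \<longlonglongrightarrow> 0" for W
  proof -
    have "?C k (- real (k * N) * \<alpha>) *\<^sub>v W (- int (k * N)) = W 0" for k
      using cocycle_iter_orbit[where U = W, OF A W, of "k * N" "- int (k * N)"] by simp
    moreover have "(\<lambda>k. vnorm (W (- int (k * N)))) \<longlonglongrightarrow> 0"
      using filterlim_compose[OF lim sub] .
    ultimately show ?thesis unfolding null_def using W(1) by (intro exI[of _ "\<lambda>k. W (- int (k * N))"]) auto
  qed
  obtain f where f: "is_basis (2*d) (d - 1) f (P 0)" using cont_subspaces_basis[OF P] .
  \<comment> \<open>A basis of \<open>P 0\<close> followed by the two decaying vectors, d + 1 in
    all. For \<open>d = 1\<close> the first branch is empty.\<close>
  define b where "b i = (if i < d - 1 then f i else if i = d - 1 then U 0 else V 0)" for i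
  have fc: "f i \<in> carrier_vec (2*d)" if "i < d - 1" for i using f that unfolding is_basis_def by blast
  have f_lin: "lin_comb (2*d) (d - 1) f c \<in> P 0" for c using f unfolding is_basis_def by blast
  have lin: "lin_comb (2*d) (d + 1) b c = lin_comb (2*d) (d - 1) f c + c (d - 1) \<cdot>\<^sub>v U 0 + c d \<cdot>\<^sub>v V 0" for c
  proof -
    have "Suc (d - 1) = d" "b (d - 1) = U 0" "b d = V 0" using d by (auto simp: b_def)
    moreover have "lin_comb (2*d) (d - 1) b c = lin_comb (2*d) (d - 1) f c"
      by (simp add: lin_comb_def b_def)
    ultimately show ?thesis
      using lin_comb_Suc[of b "d - 1" "2*d" c] lin_comb_Suc[of b d "2*d" c] U(1) V(1) by simp
  qed
  show False
  proof (rule no_isotropic_family_above_half_dim[OF S T])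
    show "b i \<in> carrier_vec (2*d)" if "i < d + 1" for i using fc U(1) V(1) by (simp add: b_def)
    have null_f: "null (f i)" if "i < d - 1" for i
    proof -
      have "lin_comb (2*d) (d - 1) f (\<lambda>j. if j = i then 1 else 0) = f i"
        using that fc[OF that] by (intro eq_vecI) (auto simp: lin_comb_def if_distrib[of "\<lambda>c. c * _"] cong: if_cong)
      then show ?thesis using nullP f_lin by metis
    qed
    have "null (b i)" for i
      using null_f null_orbit[of U, OF U bwd(1)] null_orbit[of V, OF V bwd(2)] by (simp add: b_def)
    then show "sform S (b i) (b j) = 0" for i j by (intro orth)
  next
    fix c assume 0: "lin_comb (2*d) (d + 1) b c = 0\<^sub>v (2*d)"
    \<comment> \<open>A vanishing combination puts \<open>W 0\<close> into \<open>P 0\<close>, where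
      \<open>vnorm (W 0)\<close> is at most \<open>M\<close> times the norm at any later time
      \<open>k * N\<close>. As \<open>W\<close> tends to zero forwards, \<open>W 0 = 0\<close>:
      independence of \<open>U 0\<close> and \<open>V 0\<close> then removes the last two
      coefficients, and the basis property the others.\<close>
    define W where "W n = c (d - 1) \<cdot>\<^sub>v U n + c d \<cdot>\<^sub>v V n" for n
    have W: "W n \<in> carrier_vec (2*d)" for n using U(1) V(1) by (simp add: W_def)
    let ?f = "lin_comb (2*d) (d - 1) f c"
    have W0: "W 0 = (- 1) \<cdot>\<^sub>v ?f"
    proof (rule eq_vecI)
      fix j assume "j < dim_vec ((- 1) \<cdot>\<^sub>v ?f)"
      then have j: "j < 2*d" by (simp add: lin_comb_def)
      have "lin_comb (2*d) (d + 1) b c $ j = 0" using 0 j by simp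
      then show "W 0 $ j = ((- 1) \<cdot>\<^sub>v ?f) $ j"
        unfolding lin using j carrier_vecD[OF U(1)] carrier_vecD[OF V(1)]
        by (simp add: W_def eq_neg_iff_add_eq_0 add_ac carrier_vecD[OF lin_comb_carrier])
    qed (use carrier_vecD[OF W] in \<open>simp add: lin_comb_def\<close>)
    then have WP: "W 0 \<in> P 0" using cont_subspaces_smult[OF P f_lin] by simp
    have Worb: "A (of_int n * \<alpha>) *\<^sub>v W n = W (n + 1)" for n
      unfolding W_def using U V by (simp add: mult_add_distrib_mat_vec[OF A] mult_mat_vec[OF A])
    have bound: "vnorm (W n) \<le> cmod (c (d - 1)) * (\<Sum>j<2*d. vnorm (U n)) + cmod (c d) * (\<Sum>j<2*d. vnorm (V n))" for n
    proof -
      have "vnorm (W n) \<le> (\<Sum>j<2*d. cmod (W n $ j))" using vnorm_le_sum[of "W n"] carrier_vecD[OF W] by simp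
      also have "\<dots> \<le> (\<Sum>j<2*d. cmod (c (d - 1)) * vnorm (U n) + cmod (c d) * vnorm (V n))"
      proof (intro sum_mono)
        fix j assume "j \<in> {..<2*d}"
        then have j: "j < dim_vec (U n)" "j < dim_vec (V n)" using carrier_vecD[OF U(1)] carrier_vecD[OF V(1)] by auto
        have "cmod (W n $ j) = cmod (c (d - 1) * U n $ j + c d * V n $ j)" using j by (simp add: W_def)
        also have "\<dots> \<le> cmod (c (d - 1)) * cmod (U n $ j) + cmod (c d) * cmod (V n $ j)"
          by (metis norm_mult norm_triangle_ineq)
        also have "\<dots> \<le> cmod (c (d - 1)) * vnorm (U n) + cmod (c d) * vnorm (V n)"
          using j by (intro add_mono mult_left_mono cmod_le_vnorm) auto
        finally show "cmod (W n $ j) \<le> cmod (c (d - 1)) * vnorm (U n) + cmod (c d) * vnorm (V n)" .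
      qed
      finally show ?thesis by (simp add: sum.distrib algebra_simps)
    qed
    define h where "h n = cmod (c (d - 1)) * (\<Sum>j<2*d. vnorm (U (int n))) + cmod (c d) * (\<Sum>j<2*d. vnorm (V (int n)))" for n
    have "h \<longlonglongrightarrow> cmod (c (d - 1)) * (\<Sum>j<2*d. 0) + cmod (c d) * (\<Sum>j<2*d. 0)"
      unfolding h_def by (intro tendsto_intros fwd)
    then have "h \<longlonglongrightarrow> 0" by simp
    moreover have "norm (vnorm (W (int n))) \<le> h n" for n
      using bound[of "int n"] by (simp only: h_def real_norm_def abs_of_nonneg[OF vnorm_nonneg])
    ultimately have "(\<lambda>n. vnorm (W (int n))) \<longlonglongrightarrow> 0"
      by (intro Lim_null_comparison[of "\<lambda>n. vnorm (W (int n))" h] always_eventually) auto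
    then have limW: "(\<lambda>k. vnorm (W (int (k * N)))) \<longlonglongrightarrow> 0" by (rule filterlim_compose[OF _ sub])
    have "vnorm (W 0) \<le> M * vnorm (W (int (k * N)))" for k
    proof -
      have "vnorm (W 0) \<le> M * \<rho> ^ k * vnorm (W (int (k * N)))"
        using M(2)[OF WP, of k] cocycle_iter_orbit[where U = W, OF A W Worb, of "k * N" 0] by simp
      also have "\<dots> \<le> M * 1 * vnorm (W (int (k * N)))"
        using \<rho> M(1) by (intro mult_right_mono mult_left_mono power_le_one) auto
      finally show ?thesis by simp
    qed
    moreover have "(\<lambda>k. M * vnorm (W (int (k * N)))) \<longlonglongrightarrow> M * 0" by (intro tendsto_intros limW)
    ultimately have "vnorm (W 0) \<le> M * 0" by (intro LIMSEQ_le_const) auto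
    then have "W 0 = 0\<^sub>v (2*d)" using vnorm_eq_0_iff[OF W] vnorm_nonneg[of "W 0"] by simp
    then have c2: "c (d - 1) = 0" "c d = 0" using indep unfolding W_def by blast+
    have "vnorm ?f = vnorm (W 0)" unfolding W0 vnorm_smult by simp
    then have "?f = 0\<^sub>v (2*d)"
      using vnorm_eq_0_iff[OF lin_comb_carrier] vnorm_eq_0_iff[OF W] \<open>W 0 = 0\<^sub>v (2*d)\<close> by metis
    then have "\<forall>i<d - 1. c i = 0" using f unfolding is_basis_def by blast
    moreover have "i < d - 1 \<or> i = d - 1 \<or> i = d" if "i < d + 1" for i using that by linarith
    ultimately show "\<forall>i<d + 1. c i = 0" using c2 by metis
  qed
qed

section \<open>Decaying solutions of the dual equation\<close>

lemma real_analytic_continuous: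
  assumes "real_analytic f"
  shows "continuous_on UNIV f"
proof -
  have "isCont f x0" for x0
  proof -
    obtain r c where r: "r > 0" and c: "\<And>y. \<bar>y - x0\<bar> < r \<Longrightarrow> (\<lambda>n. c n * (y - x0) ^ n) sums f y"
      using assms unfolding real_analytic_def by metis
    define g where "g h = (\<Sum>n. c n * h ^ n)" for h
    have fg: "f y = g (y - x0)" if "\<bar>y - x0\<bar> < r" for y
      using sums_unique[OF c[OF that]] by (simp add: g_def)
    \<comment> \<open>Convergence at one nonzero point already gives continuity of the power series
      at its centre.\<close>
    have "summable (\<lambda>n. c n * (r / 2) ^ n)"
      using c[of "x0 + r / 2"] r by (auto simp: sums_iff)
    then have "isCont g 0"
      unfolding g_def by (rule isCont_powser) (use r in simp)
    then have "isCont (\<lambda>y. g (y - x0)) x0"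
      using isCont_o2[of x0 "\<lambda>y. y - x0" g] by simp
    moreover have "\<forall>\<^sub>F y in nhds x0. f y = g (y - x0)"
      using r by (intro eventually_nhds_metric[THEN iffD2] exI[of _ r]) (auto simp: dist_real_def fg)
    ultimately show ?thesis using isCont_cong[of f "\<lambda>y. g (y - x0)" x0] by simp
  qed
  then show ?thesis by (simp add: continuous_at_imp_continuous_on)
qed

text \<open>Newest value first, in the order of the rows of \<open>transfer_mat\<close>: entry 0 is
  \<open>a (n + int d - 1)\<close> and entry \<open>d - 1\<close> is \<open>a n\<close>.\<close>

definition state_vec :: "nat \<Rightarrow> (int \<Rightarrow> complex) \<Rightarrow> int \<Rightarrow> complex Matrix.vec" where
  "state_vec d a n = Matrix.vec (2*d) (\<lambda>i. a (n + int d - 1 - int i))"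

lemma state_vec_carrier [simp]: "state_vec d a n \<in> carrier_vec (2*d)"
  by (simp add: state_vec_def)

text \<open>Below the first row this is a shift. In the first row the computed entry and
  \<open>a (n + int d)\<close> solve the same scalar equation with the nonzero leading coefficient
  \<open>ph (int d)\<close>, so they agree.\<close>

lemma transfer_mat_state_vec:
  assumes d: "d \<ge> 1" and ph: "ph (int d) \<noteq> 0"
    and eq: "(\<Sum>j\<in>{-int d..int d}. ph j * a (n + j)) + q x * a n = of_real E * a n"
  shows "transfer_mat ph d q E x *\<^sub>v state_vec d a n = state_vec d a (n + 1)"
proof (rule eq_vecI)
  let ?T = "transfer_mat ph d q E x"
  note step = transfer_mat_vec[where U = "state_vec d a n" and d = d and ph = ph and q = q and E = E and t = x, OF state_vec_carrier d ph]
  fix i assume "i < dim_vec (state_vec d a (n + 1))"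
  then have i: "i < 2*d" by (simp add: state_vec_def)
  show "(?T *\<^sub>v state_vec d a n) $ i = state_vec d a (n + 1) $ i"
  proof (cases i)
    case (Suc k)
    then show ?thesis using step(1)[OF i] i by (simp add: state_vec_def diff_diff_eq add_ac)
  next
    case 0
    define y where "y i = (case i of 0 \<Rightarrow> (?T *\<^sub>v state_vec d a n) $ 0 | Suc i \<Rightarrow> state_vec d a n $ i)" for i
    have ya: "y (nat (int d - k)) = a (n + k)" if k: "k \<in> {-int d..int d - 1}" for k
    proof -
      define i where "i = nat (int d - k - 1)"
      have "nat (int d - k) = Suc i" "i < 2*d" "int i = int d - k - 1" using k by (auto simp: i_def)
      then show ?thesis by (simp add: y_def state_vec_def)
    qed
    have split: "{-int d..int d} = insert (int d) {-int d..int d - 1}" by auto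
    have "(\<Sum>k\<in>{-int d..int d}. ph k * y (nat (int d - k))) = (of_real E - q x) * y d"
      using step(2) unfolding y_def .
    moreover have "y d = a n" using ya[of 0] d by simp
    moreover have "(\<Sum>k\<in>{-int d..int d - 1}. ph k * y (nat (int d - k))) = (\<Sum>k\<in>{-int d..int d - 1}. ph k * a (n + k))"
      by (intro sum.cong refl) (simp add: ya)
    ultimately have 1: "ph (int d) * y 0 + (\<Sum>k\<in>{-int d..int d - 1}. ph k * a (n + k)) = (of_real E - q x) * a n"
      unfolding split by simp
    have 2: "ph (int d) * a (n + int d) + (\<Sum>k\<in>{-int d..int d - 1}. ph k * a (n + k)) = (of_real E - q x) * a n"
      using eq unfolding split by (simp add: algebra_simps)
    have "ph (int d) * y 0 = ph (int d) * a (n + int d)"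
      using trans[OF 1 2[symmetric]] by (simp only: add_right_cancel)
    then have "y 0 = a (n + int d)" using ph by simp
    then show ?thesis using 0 i by (simp add: y_def state_vec_def add_ac)
  qed
qed (auto simp: state_vec_def transfer_mat_def)

lemma vnorm_state_vec_tendsto:
  assumes "\<And>i. i < 2*d \<Longrightarrow> (\<lambda>n. a (f n + int d - 1 - int i)) \<longlonglongrightarrow> 0"
  shows "(\<lambda>n. vnorm (state_vec d a (f n))) \<longlonglongrightarrow> 0"
proof -
  have "(\<lambda>n. vnorm (state_vec d a (f n))) \<longlonglongrightarrow> vnorm (0\<^sub>v (2*d))"
    by (rule tendsto_vnorm) (auto simp: state_vec_def intro: assms)
  then show ?thesis by (simp add: vnorm_def)
qed

lemma fourier_tendsto:
  assumes per: "\<And>x. f (x + 1) = f x" and cont: "continuous_on UNIV f"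
    and g: "filterlim (\<lambda>n. \<bar>g n\<bar>) at_top F"
  shows "((\<lambda>n. fourier f (g n)) \<longlongrightarrow> 0) F"
proof (rule tendstoI)
  fix e :: real assume "e > 0"
  then obtain K where K: "\<And>n. \<bar>n\<bar> > K \<Longrightarrow> cmod (fourier f n) < e"
    using riemann_lebesgue[OF per cont] by blast
  have "\<forall>\<^sub>F n in F. \<bar>g n\<bar> > K"
    using g[unfolded filterlim_at_top, rule_format, of "K + 1"] by (rule eventually_mono) simp
  then show "\<forall>\<^sub>F n in F. dist (fourier f (g n)) 0 < e"
    by eventually_elim (simp add: K)
qed

lemma filterlim_abs_int_shift:
  "filterlim (\<lambda>n. \<bar>int n + c\<bar>) at_top sequentially" "filterlim (\<lambda>n. \<bar>- int n + c\<bar>) at_top sequentially"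
proof -
  have "\<forall>\<^sub>F n in sequentially. Z \<le> \<bar>int n + c\<bar>" "\<forall>\<^sub>F n in sequentially. Z \<le> \<bar>- int n + c\<bar>" for Z
    by (rule eventually_sequentiallyI[of "nat (\<bar>Z\<bar> + \<bar>c\<bar>)"], linarith)+
  then show "filterlim (\<lambda>n. \<bar>int n + c\<bar>) at_top sequentially" "filterlim (\<lambda>n. \<bar>- int n + c\<bar>) at_top sequentially"
    by (simp_all add: filterlim_at_top)
qed

lemma state_vec_fourier_tendsto:
  assumes per: "\<And>x. f (x + 1) = f x" and cont: "continuous_on UNIV f"
  shows "(\<lambda>n. vnorm (state_vec d (fourier f) (int n))) \<longlonglongrightarrow> 0" "(\<lambda>n. vnorm (state_vec d (fourier f) (- int n))) \<longlonglongrightarrow> 0"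
proof -
  have eq: "k + int d - 1 - int i = k + (int d - 1 - int i)" for k i by simp
  show "(\<lambda>n. vnorm (state_vec d (fourier f) (int n))) \<longlonglongrightarrow> 0" "(\<lambda>n. vnorm (state_vec d (fourier f) (- int n))) \<longlonglongrightarrow> 0"
    by (rule vnorm_state_vec_tendsto, rule fourier_tendsto[OF per cont], unfold eq, rule filterlim_abs_int_shift)+
qed

(* A zero state vector propagates in both directions, backwards because the conserved form is nondegenerate. *)
lemma zero_orbit:
  assumes A: "\<And>x. A x \<in> carrier_mat m m" and S: "S \<in> carrier_mat m m"
    and T: "T \<in> carrier_mat m m" "T * S = 1\<^sub>m m"
    and inv: "\<And>x p q. p \<in> carrier_vec m \<Longrightarrow> q \<in> carrier_vec m \<Longrightarrow> sform S (A x *\<^sub>v p) (A x *\<^sub>v q) = sform S p q"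
    and U: "\<And>n. U n \<in> carrier_vec m" "\<And>n. A (of_int n * \<alpha>) *\<^sub>v U n = U (n + 1)" and "U 0 = 0\<^sub>v m"
  shows "U n = 0\<^sub>v m"
proof -
  have fwd: "A x *\<^sub>v 0\<^sub>v m = 0\<^sub>v m" for x using A[of x] by auto
  have inj: "p = 0\<^sub>v m" if p: "p \<in> carrier_vec m" "A x *\<^sub>v p = 0\<^sub>v m" for p x
  proof -
    have Sp: "S *\<^sub>v p \<in> carrier_vec m" using S p by auto
    have "sform S (S *\<^sub>v p) p = sform S (A x *\<^sub>v (S *\<^sub>v p)) (0\<^sub>v m)"
      using inv[OF Sp p(1), of x] p(2) by simp
    also have "\<dots> = 0"
    proof -
      have "S *\<^sub>v 0\<^sub>v m = 0\<^sub>v m" using S by auto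
      moreover have "dim_vec (A x *\<^sub>v (S *\<^sub>v p)) = m" using A[of x] by simp
      ultimately show ?thesis by (simp add: sform_def)
    qed
    finally have "S *\<^sub>v p = 0\<^sub>v m" using sform_self[of S p] vnorm_eq_0_iff[OF Sp] by simp
    then have "T *\<^sub>v (S *\<^sub>v p) = 0\<^sub>v m" using T by auto
    then show ?thesis using assoc_mult_mat_vec[OF T(1) S p(1)] T(2) one_mult_mat_vec[OF p(1)] by simp
  qed
  show ?thesis
  proof (induction n rule: int_induct[where k = 0])
    case (step1 i)
    then show ?case using U(2)[of i] fwd by simp
  next
    case (step2 i)
    then show ?case using U(2)[of "i - 1"] inj[OF U(1)] by simp
  qed (fact assms)
qed

lemma mult_mat_vec_zero: "M \<in> carrier_mat n m \<Longrightarrow> M *\<^sub>v 0\<^sub>v m = 0\<^sub>v n"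
  by (rule eq_vecI) auto

text \<open>A vector killed by \<open>F\<close> is killed by F* S F, which is the invertible matrix
  \<open>J_mat\<close>.\<close>

lemma Sp_set_injective:
  fixes a b :: complex
  assumes F: "F \<in> Sp_set wh l" and zero: "\<And>i. i < 2*l \<Longrightarrow> a * of_real (F $$ (i,0)) + b * of_real (F $$ (i,1)) = 0"
  shows "a = 0 \<and> b = 0"
proof -
  let ?F = "map_mat complex_of_real F" and ?v = "Matrix.vec 2 (\<lambda>j. if j = 0 then a else b)"
  have c: "?F \<in> carrier_mat (2*l) 2" and J: "adjoint_mat ?F * S_mat wh l * ?F = J_mat"
    using F by (auto simp: Sp_set_def)
  have ca: "adjoint_mat ?F \<in> carrier_mat 2 (2*l)" using c by (auto simp: adjoint_mat_def)
  have v: "?v \<in> carrier_vec 2" by simp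
  have "?F *\<^sub>v ?v = 0\<^sub>v (2*l)"
  proof (rule eq_vecI)
    fix i assume "i < dim_vec (0\<^sub>v (2*l) :: complex Matrix.vec)"
    then have i: "i < 2*l" by simp
    have "(?F *\<^sub>v ?v) $ i = (\<Sum>j<2. ?F $$ (i,j) * ?v $ j)" by (rule mult_mat_vec_index_sum[OF c v i])
    also have "\<dots> = 0" using c zero[OF i] i by (simp add: numeral_2_eq_2 mult.commute)
    finally show "(?F *\<^sub>v ?v) $ i = 0\<^sub>v (2*l) $ i" using i by simp
  qed (use c in auto)
  moreover have M: "adjoint_mat ?F * S_mat wh l \<in> carrier_mat 2 (2*l)"
    by (rule mult_carrier_mat[OF ca S_mat_carrier])
  moreover have "(adjoint_mat ?F * S_mat wh l) *\<^sub>v 0\<^sub>v (2*l) = 0\<^sub>v 2"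
    by (rule mult_mat_vec_zero[OF M])
  ultimately have "J_mat *\<^sub>v ?v = 0\<^sub>v 2"
    using assoc_mult_mat_vec[OF M c v] J by simp
  moreover have "(J_mat *\<^sub>v ?v) $ 0 = b" "(J_mat *\<^sub>v ?v) $ 1 = - a"
    by (simp_all add: J_mat_def scalar_prod_def numeral_2_eq_2)
  ultimately show ?thesis by simp
qed

theorem theorem5p1:
  fixes \<alpha> E :: real and vh wh :: "int \<Rightarrow> complex" and d l :: nat
    and H :: "real \<Rightarrow> real mat"
  assumes "\<alpha> \<notin> \<rat>"
    and "d \<ge> 1" and "l \<ge> 1"
    and "vh (int d) \<noteq> 0" and "wh (int l) \<noteq> 0"
    and "\<forall>x. trig_poly vh d x \<in> \<real>" and "\<forall>x. trig_poly wh l x \<in> \<real>"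
    and "analytic_Sp_map wh l H"
    and "\<forall>x. transfer_mat wh l (trig_poly vh d) E x * map_mat complex_of_real (H x)
             = map_mat complex_of_real (H (x + \<alpha>))"
  shows "\<not> PH2 d \<alpha> (transfer_mat vh d (trig_poly wh l) E)"
proof
  note d = assms(2) and l = assms(3) and vd = assms(4) and wl = assms(5) and v_real = assms(6) and w_real = assms(7)
  assume "PH2 d \<alpha> (transfer_mat vh d (trig_poly wh l) E)"
  then have dom: "dominated (2*d) (d - 1) \<alpha> (transfer_mat vh d (trig_poly wh l) E)" by (simp add: PH2_def)
  let ?H = "\<lambda>x. map_mat complex_of_real (H x)"
  have Sp: "H x \<in> Sp_set wh l" and Hper: "H (x + 1) = H x" for x
    using assms(8) by (simp_all add: analytic_Sp_map_def)
  have Hcont: "continuous_on UNIV (\<lambda>x. H x $$ (i,j))" if "i < 2*l" "j < 2" for i j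
    using assms(8) that by (intro real_analytic_continuous) (simp add: analytic_Sp_map_def)
  have Hdim: "H x \<in> carrier_mat (2*l) 2" for x using Sp by (simp add: Sp_set_def)
  then have Hc: "?H x \<in> carrier_mat (2*l) 2" for x by simp
  have Heq: "transfer_mat wh l (trig_poly vh d) E x * ?H x = ?H (x + \<alpha>)" for x using assms(9) by blast
  have l1: "l - 1 < 2*l" using l by simp
  define g where "g j x = complex_of_real (H x $$ (l - 1, j))" for j x
  have gH: "g j x = ?H x $$ (l - 1, j)" if "j < 2" for j x
    using that l1 Hdim[of x] by (simp add: g_def)
  have gper: "g j (x + 1) = g j x" and greal: "cnj (g j x) = g j x" for j x
    by (simp_all add: g_def Hper)
  have gcont: "continuous_on UNIV (g j)" if "j < 2" for j
    unfolding g_def by (intro continuous_intros Hcont l1 that)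
  have geq: "(\<Sum>k\<in>{-int l..int l}. wh k * g j (x + of_int k * \<alpha>)) + trig_poly vh d x * g j x = of_real E * g j x" if "j < 2" for j x
    using transfer_mat_conjugacy_equation[where H = ?H, OF Hc Heq that l wl] by (simp add: gH[OF that])
  define a where "a j = fourier (g j)" for j
  have dual: "(\<Sum>k\<in>{-int d..int d}. vh k * a j (n + k)) + trig_poly wh l (of_int n * \<alpha>) * a j n = of_real E * a j n" if "j < 2" for j n
    unfolding a_def by (rule fourier_dual_equation[OF w_real v_real gper gcont[OF that] greal geq[OF that]])
  let ?A = "transfer_mat vh d (trig_poly wh l) E"
  have orbit: "?A (of_int n * \<alpha>) *\<^sub>v state_vec d (a j) n = state_vec d (a j) (n + 1)" if "j < 2" for j n
    by (rule transfer_mat_state_vec[where ph = vh and d = d and a = "a j" and n = n and q = "trig_poly wh l" and E = E, OF d vd dual[OF that]])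
  obtain T where T: "T \<in> carrier_mat (2*d) (2*d)" "T * S_mat vh d = 1\<^sub>m (2*d)"
    using S_mat_left_inverse[where ph = vh and d = d, OF vd] .
  have inv: "sform (S_mat vh d) (?A x *\<^sub>v p) (?A x *\<^sub>v q) = sform (S_mat vh d) p q"
    if "p \<in> carrier_vec (2*d)" "q \<in> carrier_vec (2*d)" for x p q
    by (rule sform_transfer_mat[where ph = vh and d = d, OF that d vd]) (use trig_poly_real_coeff[OF v_real] w_real in auto)
  have decay: "(\<lambda>n. vnorm (state_vec d (a j) (int n))) \<longlonglongrightarrow> 0" "(\<lambda>n. vnorm (state_vec d (a j) (- int n))) \<longlonglongrightarrow> 0" if "j < 2" for j
    unfolding a_def by (rule state_vec_fourier_tendsto; use gper gcont[OF that] in blast)+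
  \<comment> \<open>A relation between the states at time 0 is a zero state of a combined orbit,
    which then vanishes at all times. So every Fourier coefficient of
    \<open>b0 * g 0 x + b1 * g 1 x\<close> is zero and the relation holds between the
    functions.\<close>
  have indep: "b0 = 0 \<and> b1 = 0" if 0: "b0 \<cdot>\<^sub>v state_vec d (a 0) 0 + b1 \<cdot>\<^sub>v state_vec d (a 1) 0 = 0\<^sub>v (2*d)" for b0 b1
  proof -
    let ?W = "\<lambda>n. b0 \<cdot>\<^sub>v state_vec d (a 0) n + b1 \<cdot>\<^sub>v state_vec d (a 1) n"
    have W0: "?W n = 0\<^sub>v (2*d)" for n
    proof (rule zero_orbit[where U = ?W and A = ?A and S = "S_mat vh d" and T = T and \<alpha> = \<alpha>])
      show "?A (of_int n * \<alpha>) *\<^sub>v ?W n = ?W (n + 1)" for n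
        using orbit[of 0 n] orbit[of 1 n]
        by (simp add: mult_add_distrib_mat_vec[OF transfer_mat_carrier] mult_mat_vec[OF transfer_mat_carrier])
    qed (use T inv 0 in auto)
    have "b0 * a 0 n + b1 * a 1 n = 0" for n
    proof -
      \<comment> \<open>The index is chosen so that entry 0 of the state is the coefficient with
        index \<open>n\<close>.\<close>
      have "?W (n - int d + 1) $ 0 = 0" using W0 d by simp
      then show ?thesis using d by (simp add: state_vec_def)
    qed
    then have "fourier (\<lambda>x. b0 * g 0 x + b1 * g 1 x) n = 0" for n
      using fourier_add[of "\<lambda>x. b0 * g 0 x" "\<lambda>x. b1 * g 1 x" n] gcont by (simp add: fourier_cmult a_def continuous_on_mult_left)
    then have zero: "b0 * g 0 x + b1 * g 1 x = 0" for x
      by (rule fourier_zero[rotated 2]) (auto simp: gper intro!: continuous_intros gcont)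
    have "b0 * of_real (H 0 $$ (i,0)) + b1 * of_real (H 0 $$ (i,1)) = 0" if i: "i < 2*l" for i
    proof -
      \<comment> \<open>Each row of \<open>H 0\<close> consists of values of \<open>g 0\<close> and
        \<open>g 1\<close> at a common phase, so the relation extends to the whole columns.\<close>
      have "?H 0 $$ (i,j) = g j (0 + of_int (int l - 1 - int i) * \<alpha>)" if "j < 2" for j
        using transfer_mat_conjugacy_shift[where H = ?H, OF Hc Heq that i, of 0] gH[OF that] by simp
      from this[of 0] this[of 1] show ?thesis
        using zero[of "0 + of_int (int l - 1 - int i) * \<alpha>"] i Hdim[of 0] by simp
    qed
    then show ?thesis by (rule Sp_set_injective[OF Sp])
  qed
  show False
  proof (rule symplectic_dominated_no_decaying_plane[where A = ?A and d = d and S = "S_mat vh d" and T = T and \<alpha> = \<alpha>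
        and U = "state_vec d (a 0)" and V = "state_vec d (a 1)"])
    show "continuous_on UNIV (\<lambda>x. ?A x $$ (i,j))" if "i < 2*d" "j < 2*d" for i j
      \<comment> \<open>Only the entry \<open>(0, d - 1)\<close> depends on
        \<open>x\<close>.\<close>
      using that vd by (cases "i = 0"; cases "j = d - 1") (auto simp: transfer_mat_def intro!: continuous_intros)
    show "?A (x + 1) = ?A x" for x
      unfolding transfer_mat_def trig_poly_periodic ..
    show "sform (S_mat vh d) (?A x *\<^sub>v p) (?A x *\<^sub>v q) = sform (S_mat vh d) p q"
      if "p \<in> carrier_vec (2*d)" "q \<in> carrier_vec (2*d)" for x p q
      by (rule inv[OF that])
    show "?A (of_int n * \<alpha>) *\<^sub>v state_vec d (a 0) n = state_vec d (a 0) (n + 1)"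
      "?A (of_int n * \<alpha>) *\<^sub>v state_vec d (a 1) n = state_vec d (a 1) (n + 1)" for n
      by (rule orbit, simp)+
    show "b0 = 0 \<and> b1 = 0" if "b0 \<cdot>\<^sub>v state_vec d (a 0) 0 + b1 \<cdot>\<^sub>v state_vec d (a 1) 0 = 0\<^sub>v (2*d)" for b0 b1
      by (rule indep[OF that])
    show "(\<lambda>n. vnorm (state_vec d (a 0) (int n))) \<longlonglongrightarrow> 0" "(\<lambda>n. vnorm (state_vec d (a 1) (int n))) \<longlonglongrightarrow> 0"
      "(\<lambda>n. vnorm (state_vec d (a 0) (- int n))) \<longlonglongrightarrow> 0" "(\<lambda>n. vnorm (state_vec d (a 1) (- int n))) \<longlonglongrightarrow> 0"
      by (rule decay, simp)+
  qed (fact d T dom transfer_mat_carrier S_mat_carrier state_vec_carrier)+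
qed

end
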